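(* For a self-map $\varphi:X\to X$ let $\operatorname{Stab}(\varphi)$ and $\operatorname{Atrac}(\varphi)$ denote its stable set and its attracting set. The equality $\operatorname{Stab}(\varphi)=\operatorname{Atrac}(\varphi)$ may fail in each of the following two cases: (1) there exist a Hilbert space $X$ with a countably infinite Hilbert base and a continuous linear map $\varphi:X\to X$ with dense range such that $\operatorname{Stab}(\varphi)\neq \operatorname{Atrac}(\varphi)$; (2) there exists an analytic function $\varphi$ on the open unit disc $\mathbb{D}=\{z\in\mathbb{C}: |z|<1\}$ with $|\varphi(z)|<1$ for all $z\in\mathbb{D}$, such that, as a self-map $\varphi:\mathbb{D}\to\mathbb{D}$, it satisfies $\operatorname{Stab}(\varphi)\neq \operatorname{Atrac}(\varphi)$.
   Context: For a set $X$ and a map $\varphi:X\to X$: the stable set is $$\operatorname{Stab}(\varphi)=\{x\in X\mid \exists (x_n)_{n\ge 0}\text{ in }X,\ x_0=x\text{ and }\varphi(x_{n+1})=x_n\text{ for all }n\ge 0\},$$ and the attracting set is $\operatorname{Atrac}(\varphi)=\bigcap_{n\in\mathbb{N}}\varphi^n(X)$. Hilbert spaces are over $\mathbb{C}$; a Hilbert base is an orthonormal basis in the Hilbert space sense. *)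

theory Defs
  imports
    "HOL-Complex_Analysis.Complex_Analysis"
    "HOL-Algebra.Module"
    "HOL-Algebra.Algebraic_Closure_Type"
begin

text \<open>Both HOL-Algebra and HOL-Analysis use \<open>closure_of\<close>; here it is the topological closure.\<close>

no_notation Congruence.eq_closure_of (\<open>closure'_of\<index>\<close>)


section \<open>Stable and attracting sets of a self-map\<close>

definition stable_set :: "'a set \<Rightarrow> ('a \<Rightarrow> 'a) \<Rightarrow> 'a set" where
  "stable_set A \<phi> =
     {x \<in> A. \<exists>s :: nat \<Rightarrow> 'a. (\<forall>n. s n \<in> A) \<and> s 0 = x \<and> (\<forall>n. \<phi> (s (Suc n)) = s n)}"

definition attracting_set :: "'a set \<Rightarrow> ('a \<Rightarrow> 'a) \<Rightarrow> 'a set" where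
  "attracting_set A \<phi> = (\<Inter>n::nat. (\<phi> ^^ n) ` A)"


section \<open>Complex Hilbert spaces\<close>

text \<open>
  Vector spaces are modules with an explicit carrier, so that one can quantify existentially
  over Hilbert spaces. Only the additive part and the scalar multiplication of the module
  record matter; its fields for multiplication and one are unconstrained.
\<close>

abbreviation complex_field :: "complex ring" where
  "complex_field \<equiv> ring_of_type_algebra"

definition ip_norm :: "('a \<Rightarrow> 'a \<Rightarrow> complex) \<Rightarrow> 'a \<Rightarrow> real" where
  "ip_norm ip x = sqrt (Re (ip x x))"

text \<open>
  The locale \<^locale>\<open>Metric_space\<close> requires nonnegativity and symmetry of the distance also
  outside the carrier, whence the value 0 there.
\<close>

definition ip_dist :: "(complex, 'a) module \<Rightarrow> ('a \<Rightarrow> 'a \<Rightarrow> complex) \<Rightarrow> 'a \<Rightarrow> 'a \<Rightarrow> real" where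
  "ip_dist V ip x y =
     (if x \<in> carrier V \<and> y \<in> carrier V then ip_norm ip (x \<ominus>\<^bsub>V\<^esub> y) else 0)"

locale complex_inner_product_space = module complex_field V
  for V :: "(complex, 'a) module" (structure) +
  fixes ip :: "'a \<Rightarrow> 'a \<Rightarrow> complex"
  assumes ip_add_left:
      "\<lbrakk>x \<in> carrier V; y \<in> carrier V; z \<in> carrier V\<rbrakk>
        \<Longrightarrow> ip (x \<oplus>\<^bsub>V\<^esub> y) z = ip x z + ip y z"
    and ip_smult_left:
      "\<lbrakk>x \<in> carrier V; y \<in> carrier V\<rbrakk> \<Longrightarrow> ip (c \<odot>\<^bsub>V\<^esub> x) y = c * ip x y"
    and ip_cnj: "\<lbrakk>x \<in> carrier V; y \<in> carrier V\<rbrakk> \<Longrightarrow> ip x y = cnj (ip y x)"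
    and ip_pos: "\<lbrakk>x \<in> carrier V; x \<noteq> \<zero>\<^bsub>V\<^esub>\<rbrakk> \<Longrightarrow> 0 < Re (ip x x)"
begin

lemma carrier_complex_field [simp]: "carrier complex_field = UNIV"
  by (simp add: ring_of_type_algebra_def)

lemma smult_in_carrier: "x \<in> carrier V \<Longrightarrow> c \<odot>\<^bsub>V\<^esub> x \<in> carrier V"
  by (rule smult_closed) simp_all

lemma ip_zero_left: "y \<in> carrier V \<Longrightarrow> ip \<zero>\<^bsub>V\<^esub> y = 0"
  using ip_add_left[of "\<zero>\<^bsub>V\<^esub>" "\<zero>\<^bsub>V\<^esub>" y] by simp

lemma ip_uminus_left:
  assumes "x \<in> carrier V" "y \<in> carrier V"
  shows "ip (\<ominus>\<^bsub>V\<^esub> x) y = - ip x y"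
proof -
  have "ip x y + ip (\<ominus>\<^bsub>V\<^esub> x) y = ip (x \<oplus>\<^bsub>V\<^esub> (\<ominus>\<^bsub>V\<^esub> x)) y"
    using assms by (simp add: ip_add_left)
  also have "\<dots> = 0"
    using assms by (simp add: M.r_neg ip_zero_left)
  finally show ?thesis
    by (simp add: add_eq_0_iff)
qed

lemma ip_diff_left:
  assumes "x \<in> carrier V" "y \<in> carrier V" "z \<in> carrier V"
  shows "ip (x \<ominus>\<^bsub>V\<^esub> y) z = ip x z - ip y z"
  using assms by (simp add: a_minus_def ip_add_left ip_uminus_left)

lemma ip_add_right:
  assumes "x \<in> carrier V" "y \<in> carrier V" "z \<in> carrier V"
  shows "ip z (x \<oplus>\<^bsub>V\<^esub> y) = ip z x + ip z y"
  using assms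
  by (simp add: ip_cnj[of z "x \<oplus>\<^bsub>V\<^esub> y"] ip_cnj[of z x] ip_cnj[of z y] ip_add_left)

lemma ip_diff_right:
  assumes "x \<in> carrier V" "y \<in> carrier V" "z \<in> carrier V"
  shows "ip z (x \<ominus>\<^bsub>V\<^esub> y) = ip z x - ip z y"
  using assms
  by (simp add: ip_cnj[of z "x \<ominus>\<^bsub>V\<^esub> y"] ip_cnj[of z x] ip_cnj[of z y] ip_diff_left)

lemma ip_smult_right:
  assumes "x \<in> carrier V" "y \<in> carrier V"
  shows "ip x (c \<odot>\<^bsub>V\<^esub> y) = cnj c * ip x y"
  using assms
  by (simp add: ip_cnj[of x "c \<odot>\<^bsub>V\<^esub> y"] ip_cnj[of x y] ip_smult_left smult_in_carrier)

lemma ip_nonneg: "x \<in> carrier V \<Longrightarrow> 0 \<le> Re (ip x x)"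
  using ip_pos[of x] ip_zero_left[of "\<zero>\<^bsub>V\<^esub>"] by (cases "x = \<zero>\<^bsub>V\<^esub>") auto

lemma ip_self:
  assumes "x \<in> carrier V"
  shows "ip x x = complex_of_real (Re (ip x x))"
proof -
  have "ip x x \<in> \<real>"
    unfolding Reals_cnj_iff by (rule ip_cnj[OF assms assms, symmetric])
  then show ?thesis
    by (rule of_real_Re[symmetric])
qed

lemma Cauchy_Schwarz:
  assumes x: "x \<in> carrier V" and y: "y \<in> carrier V"
  shows "cmod (ip x y) \<le> ip_norm ip x * ip_norm ip y"
proof -
  have "(cmod (ip x y))\<^sup>2 \<le> Re (ip x x) * Re (ip y y)"
  proof (cases "y = \<zero>\<^bsub>V\<^esub>")
    case True
    then have "ip x y = 0"
      using ip_cnj[OF x y] ip_zero_left[OF x] by simp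
    then show ?thesis
      using ip_nonneg[OF x] ip_nonneg[OF y] by simp
  next
    case False
    define a where "a = Re (ip x x)"
    define c where "c = Re (ip y y)"
    define b where "b = ip x y"
    have c: "c > 0"
      using ip_pos[OF y False] by (simp add: c_def)
    have xx: "ip x x = of_real a" and yy: "ip y y = of_real c" and yx: "ip y x = cnj b"
      unfolding a_def b_def c_def by (rule ip_self[OF x], rule ip_self[OF y], rule ip_cnj[OF y x])
    define w where "w = (of_real c \<odot>\<^bsub>V\<^esub> x) \<ominus>\<^bsub>V\<^esub> (b \<odot>\<^bsub>V\<^esub> y)"
    have w: "w \<in> carrier V"
      using x y by (simp add: w_def smult_in_carrier)
    have "ip w w = of_real c * (of_real c * of_real a - b * cnj b)"
      using x y by (simp add: w_def ip_diff_left ip_diff_right ip_smult_left ip_smult_right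
          smult_in_carrier xx yy yx b_def[symmetric] algebra_simps)
    also have "\<dots> = of_real (c * (c * a - (cmod b)\<^sup>2))"
      by (simp only: complex_norm_square of_real_mult of_real_diff)
    finally have "0 \<le> c * (c * a - (cmod b)\<^sup>2)"
      using ip_nonneg[OF w] by simp
    then have "(cmod b)\<^sup>2 \<le> a * c"
      using c by (simp add: zero_le_mult_iff mult.commute)
    then show ?thesis
      by (simp add: a_def b_def c_def)
  qed
  then have "cmod (ip x y) \<le> sqrt (Re (ip x x) * Re (ip y y))"
    by (rule real_le_rsqrt)
  then show ?thesis
    by (simp add: ip_norm_def real_sqrt_mult)
qed

lemma ip_norm_triangle:
  assumes x: "x \<in> carrier V" and y: "y \<in> carrier V"
  shows "ip_norm ip (x \<oplus>\<^bsub>V\<^esub> y) \<le> ip_norm ip x + ip_norm ip y"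
proof -
  have sq: "(ip_norm ip z)\<^sup>2 = Re (ip z z)" if "z \<in> carrier V" for z
    using ip_nonneg[OF that] by (simp add: ip_norm_def)
  have nn: "0 \<le> ip_norm ip z" if "z \<in> carrier V" for z
    using ip_nonneg[OF that] by (simp add: ip_norm_def)
  have "Re (ip y x) = Re (ip x y)"
    using ip_cnj[OF x y] by simp
  then have "(ip_norm ip (x \<oplus>\<^bsub>V\<^esub> y))\<^sup>2 = (ip_norm ip x)\<^sup>2 + 2 * Re (ip x y) + (ip_norm ip y)\<^sup>2"
    using x y by (simp add: sq ip_add_left ip_add_right)
  also have "\<dots> \<le> (ip_norm ip x)\<^sup>2 + 2 * (ip_norm ip x * ip_norm ip y) + (ip_norm ip y)\<^sup>2"
    using Cauchy_Schwarz[OF x y] complex_Re_le_cmod[of "ip x y"] by simp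
  also have "\<dots> = (ip_norm ip x + ip_norm ip y)\<^sup>2"
    by (simp only: power2_sum mult.assoc ac_simps)
  finally show ?thesis
    by (rule power2_le_imp_le) (intro add_nonneg_nonneg nn x y)
qed

sublocale Metric_space "carrier V" "ip_dist V ip"
proof
  show "0 \<le> ip_dist V ip x y" for x y
    by (simp add: ip_dist_def ip_norm_def ip_nonneg)
  show "ip_dist V ip x y = ip_dist V ip y x" for x y
    by (auto simp: ip_dist_def ip_norm_def ip_diff_left ip_diff_right)
  show "ip_dist V ip x y = 0 \<longleftrightarrow> x = y" if "x \<in> carrier V" "y \<in> carrier V" for x y
  proof
    assume "ip_dist V ip x y = 0"
    then have "Re (ip (x \<ominus>\<^bsub>V\<^esub> y) (x \<ominus>\<^bsub>V\<^esub> y)) = 0"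
      using that by (simp add: ip_dist_def ip_norm_def)
    then have "x \<ominus>\<^bsub>V\<^esub> y = \<zero>\<^bsub>V\<^esub>"
      using ip_pos[of "x \<ominus>\<^bsub>V\<^esub> y"] that by force
    moreover have "x = (x \<ominus>\<^bsub>V\<^esub> y) \<oplus>\<^bsub>V\<^esub> y"
      using that by (simp add: a_minus_def M.a_assoc M.l_neg)
    ultimately show "x = y"
      using that by simp
  next
    assume "x = y"
    then show "ip_dist V ip x y = 0"
      using that by (simp add: ip_dist_def ip_norm_def ip_diff_left)
  qed
  show "ip_dist V ip x z \<le> ip_dist V ip x y + ip_dist V ip y z"
    if "x \<in> carrier V" "y \<in> carrier V" "z \<in> carrier V" for x y z
  proof -
    have "x \<ominus>\<^bsub>V\<^esub> z = (x \<ominus>\<^bsub>V\<^esub> y) \<oplus>\<^bsub>V\<^esub> (y \<ominus>\<^bsub>V\<^esub> z)"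
      using that by (simp add: a_minus_def M.a_assoc M.r_neg1)
    then show ?thesis
      using that ip_norm_triangle[of "x \<ominus>\<^bsub>V\<^esub> y" "y \<ominus>\<^bsub>V\<^esub> z"] by (simp add: ip_dist_def)
  qed
qed

end

locale complex_hilbert_space = complex_inner_product_space +
  assumes complete: "mcomplete"

abbreviation hilbert_topology ::
    "(complex, 'a) module \<Rightarrow> ('a \<Rightarrow> 'a \<Rightarrow> complex) \<Rightarrow> 'a topology" where
  "hilbert_topology V ip \<equiv> Metric_space.mtopology (carrier V) (ip_dist V ip)"

definition linear_span :: "(complex, 'a) module \<Rightarrow> 'a set \<Rightarrow> 'a set" where
  "linear_span V B =
     {(\<Oplus>\<^bsub>V\<^esub>b\<in>F. c b \<odot>\<^bsub>V\<^esub> b) | F c. finite F \<and> F \<subseteq> B}"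

definition hilbert_base ::
    "(complex, 'a) module \<Rightarrow> ('a \<Rightarrow> 'a \<Rightarrow> complex) \<Rightarrow> 'a set \<Rightarrow> bool" where
  "hilbert_base V ip B \<longleftrightarrow>
     B \<subseteq> carrier V \<and>
     (\<forall>b\<in>B. \<forall>b'\<in>B. ip b b' = (if b = b' then 1 else 0)) \<and>
     hilbert_topology V ip closure_of linear_span V B = carrier V"

definition linear_self_map :: "(complex, 'a) module \<Rightarrow> ('a \<Rightarrow> 'a) \<Rightarrow> bool" where
  "linear_self_map V \<phi> \<longleftrightarrow>
     \<phi> \<in> carrier V \<rightarrow> carrier V \<and>
     (\<forall>x\<in>carrier V. \<forall>y\<in>carrier V. \<phi> (x \<oplus>\<^bsub>V\<^esub> y) = \<phi> x \<oplus>\<^bsub>V\<^esub> \<phi> y) \<and>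
     (\<forall>c. \<forall>x\<in>carrier V. \<phi> (c \<odot>\<^bsub>V\<^esub> x) = c \<odot>\<^bsub>V\<^esub> \<phi> x)"

end

theory Submission
  imports Defs
begin

text \<open>
  For (1), let a root have a chain of preimages of length \<open>n\<close> for every \<open>n\<close>, one on each of infinitely
  many branches. The root is then attracted, but an infinite backward orbit would have to continue
  one of the branches beyond its end. To make the range dense, the end of each branch is
  identified with the image of a vector spanning the kernel of an operator with dense range that
  does not contain this vector.

  For (2), replace the disc by the upper half-plane and take \<open>\<phi> z = z + \<i> / C z\<close> with
  \<open>C z = 1 + (\<Sum>j. \<i> * \<nu> j / (z - p j))\<close> and poles \<open>p j\<close> slightly below the real axis. Since
  \<open>Re (C z) \<ge> 1\<close>, every step raises the imaginary part at least by its squared length. Along an infinite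
  backward orbit the steps thus tend to 0, which forces the orbit to stay close to a single pole;
  but there \<open>C\<close> is bounded on the half-plane, so the steps do not tend to 0. On the
  other hand \<open>\<phi>\<close> maps a small neighbourhood of each repelling fixed point \<open>p k\<close> onto a
  neighbourhood of \<open>\<i> / 2\<close>, and \<open>p k\<close> is so close to the axis that the resulting backward
  orbit of \<open>\<i> / 2\<close> stays in the half-plane for more than \<open>k\<close> steps.
\<close>

section \<open>The Hilbert space of square-summable sequences\<close>

definition ell2 :: "(nat \<Rightarrow> complex) set" where
  "ell2 = {x. summable (\<lambda>m. (cmod (x m))\<^sup>2)}"

definition ell2_ip :: "(nat \<Rightarrow> complex) \<Rightarrow> (nat \<Rightarrow> complex) \<Rightarrow> complex" where
  "ell2_ip x y = (\<Sum>m. x m * cnj (y m))"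

definition ell2_module :: "(complex, nat \<Rightarrow> complex) module" where
  "ell2_module =
     \<lparr>carrier = ell2, monoid.mult = (\<lambda>x y. x), one = (\<lambda>m. 0), ring.zero = (\<lambda>m. 0),
      add = (\<lambda>x y m. x m + y m), smult = (\<lambda>c x m. c * x m)\<rparr>"

lemma ell2_module_simps [simp]:
  "carrier ell2_module = ell2"
  "\<zero>\<^bsub>ell2_module\<^esub> = (\<lambda>m. 0)"
  "x \<oplus>\<^bsub>ell2_module\<^esub> y = (\<lambda>m. x m + y m)"
  "c \<odot>\<^bsub>ell2_module\<^esub> x = (\<lambda>m. c * x m)"
  by (simp_all add: ell2_module_def)

lemma norm_add_sq_le: "(norm (a + b))\<^sup>2 \<le> 2 * (norm a)\<^sup>2 + 2 * (norm b)\<^sup>2"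
  for a b :: "'a :: real_normed_vector"
proof -
  have "(norm (a + b))\<^sup>2 \<le> (norm a + norm b)\<^sup>2"
    by (intro power_mono norm_triangle_ineq) simp
  also have "\<dots> \<le> 2 * (norm a)\<^sup>2 + 2 * (norm b)\<^sup>2"
    using zero_le_power2[of "norm a - norm b"] by (simp add: power2_eq_square algebra_simps)
  finally show ?thesis .
qed

lemma ell2_zero [simp]: "(\<lambda>m. 0) \<in> ell2"
  by (simp add: ell2_def)

lemma ell2_add [intro]: "x \<in> ell2 \<Longrightarrow> y \<in> ell2 \<Longrightarrow> (\<lambda>m. x m + y m) \<in> ell2"
  unfolding ell2_def mem_Collect_eq
  by (rule summable_comparison_test'[where N = 0
        and g = "\<lambda>m. 2 * (cmod (x m))\<^sup>2 + 2 * (cmod (y m))\<^sup>2"])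
    (auto intro!: summable_add summable_mult simp: norm_add_sq_le)

lemma ell2_smult [intro]: "x \<in> ell2 \<Longrightarrow> (\<lambda>m. c * x m) \<in> ell2"
  by (simp add: ell2_def norm_mult power_mult_distrib summable_mult)

lemma ell2_uminus [intro]: "x \<in> ell2 \<Longrightarrow> (\<lambda>m. - x m) \<in> ell2"
  by (simp add: ell2_def)

lemma ell2_diff [intro]: "x \<in> ell2 \<Longrightarrow> y \<in> ell2 \<Longrightarrow> (\<lambda>m. x m - y m) \<in> ell2"
  using ell2_add[OF _ ell2_uminus, of x y] by simp

lemma ell2_tendsto_0:
  assumes "x \<in> ell2"
  shows "x \<longlonglongrightarrow> 0"
proof -
  have "(\<lambda>m. (cmod (x m))\<^sup>2) \<longlonglongrightarrow> 0"
    using assms unfolding ell2_def mem_Collect_eq by (rule summable_LIMSEQ_zero)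
  from tendsto_real_sqrt[OF this] have "(\<lambda>m. cmod (x m)) \<longlonglongrightarrow> 0"
    unfolding real_sqrt_abs by (simp only: abs_norm_cancel real_sqrt_zero)
  then show ?thesis
    by (rule tendsto_norm_zero_cancel)
qed

lemma summable_ell2_ip:
  assumes "x \<in> ell2" "y \<in> ell2"
  shows "summable (\<lambda>m. x m * cnj (y m))"
proof (rule summable_comparison_test'[where N = 0 and g = "\<lambda>m. (cmod (x m))\<^sup>2 + (cmod (y m))\<^sup>2"])
  show "summable (\<lambda>m. (cmod (x m))\<^sup>2 + (cmod (y m))\<^sup>2)"
    using assms by (simp add: ell2_def summable_add)
  show "norm (x m * cnj (y m)) \<le> (cmod (x m))\<^sup>2 + (cmod (y m))\<^sup>2" for m
    using sum_squares_bound[of "cmod (x m)" "cmod (y m)"]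
      zero_le_power2[of "cmod (x m)"] zero_le_power2[of "cmod (y m)"]
    unfolding norm_mult complex_mod_cnj by linarith
qed

lemma ell2_ip_self:
  assumes "x \<in> ell2"
  shows "ell2_ip x x = complex_of_real (\<Sum>m. (cmod (x m))\<^sup>2)"
  using assms unfolding ell2_ip_def complex_norm_square[symmetric]
  by (subst suminf_of_real) (simp_all add: ell2_def)

lemma module_ell2: "module complex_field ell2_module"
proof (rule moduleI)
  show "cring complex_field"
    by (rule cring_from_type_algebra)
  show "abelian_group ell2_module"
  proof (rule abelian_groupI)
    show "\<exists>y\<in>carrier ell2_module. y \<oplus>\<^bsub>ell2_module\<^esub> x = \<zero>\<^bsub>ell2_module\<^esub>"
      if "x \<in> carrier ell2_module" for x
      using that by (intro bexI[of _ "\<lambda>m. - x m"]) auto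
  qed (auto simp: algebra_simps)
qed (auto simp: ring_of_type_algebra_def algebra_simps)

interpretation ell2: complex_inner_product_space ell2_module ell2_ip
proof (intro complex_inner_product_space.intro complex_inner_product_space_axioms.intro)
  show "module complex_field ell2_module"
    by (rule module_ell2)
  fix x y z :: "nat \<Rightarrow> complex" and c :: complex
  show "ell2_ip (x \<oplus>\<^bsub>ell2_module\<^esub> y) z = ell2_ip x z + ell2_ip y z"
    if "x \<in> carrier ell2_module" "y \<in> carrier ell2_module" "z \<in> carrier ell2_module"
    using that by (simp add: ell2_ip_def ring_distribs suminf_add[symmetric] summable_ell2_ip)
  show "ell2_ip (c \<odot>\<^bsub>ell2_module\<^esub> x) y = c * ell2_ip x y"
    if "x \<in> carrier ell2_module" "y \<in> carrier ell2_module"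
    using that by (simp add: ell2_ip_def mult.assoc suminf_mult summable_ell2_ip)
  show "ell2_ip x y = cnj (ell2_ip y x)"
    if "x \<in> carrier ell2_module" "y \<in> carrier ell2_module"
  proof -
    have "(\<lambda>m. y m * cnj (x m)) sums ell2_ip y x"
      using that by (simp add: ell2_ip_def summable_ell2_ip summable_sums)
    then have "(\<lambda>m. cnj (y m * cnj (x m))) sums cnj (ell2_ip y x)"
      by (simp only: sums_cnj)
    then show ?thesis
      by (simp add: ell2_ip_def sums_iff mult.commute)
  qed
  show "0 < Re (ell2_ip x x)" if "x \<in> carrier ell2_module" "x \<noteq> \<zero>\<^bsub>ell2_module\<^esub>"
  proof -
    obtain m where "x m \<noteq> 0"
      using \<open>x \<noteq> \<zero>\<^bsub>ell2_module\<^esub>\<close> by auto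
    moreover have "summable (\<lambda>m. (cmod (x m))\<^sup>2)"
      using that by (simp add: ell2_def)
    ultimately have "0 < (\<Sum>m. (cmod (x m))\<^sup>2)"
      by (intro suminf_pos2[where i = m]) auto
    then show ?thesis
      using that by (simp add: ell2_ip_self)
  qed
qed

section \<open>Norm, distance and completeness\<close>

lemma ell2_minus:
  assumes "x \<in> ell2" "y \<in> ell2"
  shows "x \<ominus>\<^bsub>ell2_module\<^esub> y = (\<lambda>m. x m - y m)"
proof -
  have "\<ominus>\<^bsub>ell2_module\<^esub> y = (\<lambda>m. - y m)"
    using assms by (intro ell2.M.minus_equality) auto
  then show ?thesis
    by (simp add: a_minus_def)
qed

lemma ell2_norm_eq: "x \<in> ell2 \<Longrightarrow> ip_norm ell2_ip x = sqrt (\<Sum>m. (cmod (x m))\<^sup>2)"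
  by (simp add: ip_norm_def ell2_ip_self)

lemma ell2_dist_eq:
  "x \<in> ell2 \<Longrightarrow> y \<in> ell2 \<Longrightarrow>
    ip_dist ell2_module ell2_ip x y = sqrt (\<Sum>m. (cmod (x m - y m))\<^sup>2)"
  by (simp add: ip_dist_def ell2_minus ell2_norm_eq ell2_diff)

text \<open>A Cauchy sequence converges in every coordinate. The partial sums of squared differences
  are bounded independently of the cut-off \<open>K\<close>, so letting the second index and then
  \<open>K\<close> tend to infinity bounds the distance to the coordinatewise limit.\<close>

lemma ell2_limit:
  fixes \<sigma> :: "nat \<Rightarrow> nat \<Rightarrow> complex"
  assumes cauchy: "\<And>\<epsilon>. \<epsilon> > 0 \<Longrightarrow> \<exists>N. \<forall>n\<ge>N. \<forall>n'\<ge>N. ip_dist ell2_module ell2_ip (\<sigma> n) (\<sigma> n') < \<epsilon>"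
    and \<sigma>: "\<And>n. \<sigma> n \<in> ell2"
  obtains l where "l \<in> ell2"
    "\<And>\<epsilon>. \<epsilon> > 0 \<Longrightarrow> \<exists>N. \<forall>n\<ge>N. ip_dist ell2_module ell2_ip (\<sigma> n) l < \<epsilon>"
proof -
  define l where "l = (\<lambda>m. lim (\<lambda>n. \<sigma> n m))"
  have partial: "(\<Sum>m<K. (cmod (\<sigma> n m - \<sigma> n' m))\<^sup>2) \<le> \<epsilon>\<^sup>2"
    if "ip_dist ell2_module ell2_ip (\<sigma> n) (\<sigma> n') < \<epsilon>" for n n' K \<epsilon>
  proof -
    have s: "summable (\<lambda>m. (cmod (\<sigma> n m - \<sigma> n' m))\<^sup>2)"
      using ell2_diff[OF \<sigma> \<sigma>, of n n'] by (simp add: ell2_def)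
    have "(\<Sum>m<K. (cmod (\<sigma> n m - \<sigma> n' m))\<^sup>2) \<le> (\<Sum>m. (cmod (\<sigma> n m - \<sigma> n' m))\<^sup>2)"
      by (rule sum_le_suminf[OF s]) auto
    also have "\<dots> = (ip_dist ell2_module ell2_ip (\<sigma> n) (\<sigma> n'))\<^sup>2"
      using s by (simp add: ell2_dist_eq \<sigma> suminf_nonneg)
    also have "\<dots> \<le> \<epsilon>\<^sup>2"
      using that by (intro power_mono) auto
    finally show ?thesis .
  qed
  have "Cauchy (\<lambda>n. \<sigma> n m)" for m
  proof (rule metric_CauchyI)
    fix \<epsilon> :: real
    assume "\<epsilon> > 0"
    then obtain N where N: "\<And>n n'. n \<ge> N \<Longrightarrow> n' \<ge> N \<Longrightarrow>
        ip_dist ell2_module ell2_ip (\<sigma> n) (\<sigma> n') < \<epsilon> / 2"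
      using cauchy[of "\<epsilon> / 2"] by auto
    have "dist (\<sigma> n m) (\<sigma> n' m) < \<epsilon>" if "n \<ge> N" "n' \<ge> N" for n n'
    proof -
      have "(cmod (\<sigma> n m - \<sigma> n' m))\<^sup>2 \<le> (\<Sum>m<Suc m. (cmod (\<sigma> n m - \<sigma> n' m))\<^sup>2)"
        by (simp add: sum_nonneg)
      also have "\<dots> \<le> (\<epsilon> / 2)\<^sup>2"
        by (rule partial[OF N[OF that]])
      finally have "cmod (\<sigma> n m - \<sigma> n' m) \<le> \<epsilon> / 2"
        by (rule power2_le_imp_le) (use \<open>\<epsilon> > 0\<close> in simp)
      then show ?thesis
        using \<open>\<epsilon> > 0\<close> by (simp add: dist_norm)
    qed
    then show "\<exists>N. \<forall>n\<ge>N. \<forall>n'\<ge>N. dist (\<sigma> n m) (\<sigma> n' m) < \<epsilon>"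
      by blast
  qed
  then have "convergent (\<lambda>n. \<sigma> n m)" for m
    by (rule Cauchy_convergent)
  then have l: "(\<lambda>n. \<sigma> n m) \<longlonglongrightarrow> l m" for m
    unfolding l_def convergent_LIMSEQ_iff .
  have tail: "summable (\<lambda>m. (cmod (\<sigma> n m - l m))\<^sup>2) \<and> (\<Sum>m. (cmod (\<sigma> n m - l m))\<^sup>2) \<le> \<epsilon>\<^sup>2"
    if "\<And>n'. n' \<ge> N \<Longrightarrow> ip_dist ell2_module ell2_ip (\<sigma> n) (\<sigma> n') < \<epsilon>" for n N \<epsilon>
  proof -
    have "(\<Sum>m<K. (cmod (\<sigma> n m - l m))\<^sup>2) \<le> \<epsilon>\<^sup>2" for K
    proof (rule LIMSEQ_le_const2)
      show "(\<lambda>n'. \<Sum>m<K. (cmod (\<sigma> n m - \<sigma> n' m))\<^sup>2) \<longlonglongrightarrow> (\<Sum>m<K. (cmod (\<sigma> n m - l m))\<^sup>2)"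
        by (intro tendsto_intros l)
      show "\<exists>N. \<forall>n'\<ge>N. (\<Sum>m<K. (cmod (\<sigma> n m - \<sigma> n' m))\<^sup>2) \<le> \<epsilon>\<^sup>2"
        using partial that by blast
    qed
    then show ?thesis
      by (intro conjI summableI_nonneg_bounded[where x = "\<epsilon>\<^sup>2"] suminf_le_const) auto
  qed
  \<comment> \<open>The limit is \<open>\<sigma> N1\<close> minus a square-summable sequence, hence
    itself square-summable.\<close>
  obtain N1 where "\<And>n n'. n \<ge> N1 \<Longrightarrow> n' \<ge> N1 \<Longrightarrow>
      ip_dist ell2_module ell2_ip (\<sigma> n) (\<sigma> n') < 1"
    using cauchy[of 1] by auto
  then have "(\<lambda>m. \<sigma> N1 m - l m) \<in> ell2"
    using tail[of N1 N1 1] by (simp add: ell2_def)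
  from ell2_diff[OF \<sigma>[of N1] this] have "l \<in> ell2"
    by simp
  show thesis
  proof
    show "l \<in> ell2" by fact
    fix \<epsilon> :: real
    assume "\<epsilon> > 0"
    then obtain N where N: "\<And>n n'. n \<ge> N \<Longrightarrow> n' \<ge> N \<Longrightarrow>
        ip_dist ell2_module ell2_ip (\<sigma> n) (\<sigma> n') < \<epsilon> / 2"
      using cauchy[of "\<epsilon> / 2"] by auto
    have "ip_dist ell2_module ell2_ip (\<sigma> n) l < \<epsilon>" if "n \<ge> N" for n
    proof -
      have "(\<Sum>m. (cmod (\<sigma> n m - l m))\<^sup>2) \<le> (\<epsilon> / 2)\<^sup>2"
        using tail[of N n "\<epsilon> / 2"] N that by blast
      then have "ip_dist ell2_module ell2_ip (\<sigma> n) l \<le> \<epsilon> / 2"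
        unfolding ell2_dist_eq[OF \<sigma> \<open>l \<in> ell2\<close>] using \<open>\<epsilon> > 0\<close> by (intro real_le_lsqrt) auto
      then show ?thesis
        using \<open>\<epsilon> > 0\<close> by simp
    qed
    then show "\<exists>N. \<forall>n\<ge>N. ip_dist ell2_module ell2_ip (\<sigma> n) l < \<epsilon>"
      by blast
  qed
qed

lemma complex_hilbert_space_ell2: "complex_hilbert_space ell2_module ell2_ip"
proof
  show "ell2.mcomplete"
    unfolding ell2.mcomplete_def
  proof (intro allI impI)
    fix \<sigma> :: "nat \<Rightarrow> nat \<Rightarrow> complex"
    assume C: "ell2.MCauchy \<sigma>"
    then have \<sigma>: "\<sigma> n \<in> ell2" for n
      unfolding ell2.MCauchy_def by auto
    obtain l where "l \<in> ell2"
      and l: "\<And>\<epsilon>. \<epsilon> > 0 \<Longrightarrow> \<exists>N. \<forall>n\<ge>N. ip_dist ell2_module ell2_ip (\<sigma> n) l < \<epsilon>"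
      using ell2_limit[of \<sigma>] C \<sigma> unfolding ell2.MCauchy_def by metis
    then have "limitin ell2.mtopology \<sigma> l sequentially"
      using \<sigma> unfolding ell2.limitin_metric eventually_sequentially by auto
    then show "\<exists>x. limitin ell2.mtopology \<sigma> x sequentially"
      by blast
  qed
qed

section \<open>Coordinate vectors, truncation and the Hilbert base\<close>

definition unit_seq :: "nat \<Rightarrow> nat \<Rightarrow> complex" where
  "unit_seq m j = (if j = m then 1 else 0)"

definition truncate_seq :: "nat \<Rightarrow> (nat \<Rightarrow> complex) \<Rightarrow> nat \<Rightarrow> complex" where
  "truncate_seq K x m = (if m < K then x m else 0)"

lemma ell2_finite_support: "finite {m. x m \<noteq> 0} \<Longrightarrow> x \<in> ell2"
  by (auto simp: ell2_def intro!: summable_finite[of "{m. x m \<noteq> 0}"])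

lemma unit_seq_in_ell2 [simp]: "unit_seq m \<in> ell2"
  by (rule ell2_finite_support) (simp add: unit_seq_def)

lemma truncate_seq_in_ell2 [simp]: "truncate_seq K x \<in> ell2"
  by (rule ell2_finite_support) (rule finite_subset[of _ "{..<K}"], auto simp: truncate_seq_def)

lemma ell2_ip_unit_seq_left: "ell2_ip (unit_seq m) y = cnj (y m)"
proof -
  have "ell2_ip (unit_seq m) y = (\<Sum>j\<in>{m}. unit_seq m j * cnj (y j))"
    unfolding ell2_ip_def by (rule suminf_finite) (auto simp: unit_seq_def)
  then show ?thesis
    by (simp add: unit_seq_def)
qed

lemma inj_unit_seq: "inj unit_seq"
proof (rule injI)
  fix m m'
  assume "unit_seq m = unit_seq m'"
  then have "unit_seq m m = unit_seq m' m"
    by simp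
  then show "m = m'"
    by (simp add: unit_seq_def split: if_splits)
qed

text \<open>The tails of a convergent series tend to 0, so every vector is the limit of its
  truncations. This yields density both of the span of the coordinate vectors and of the range of
  \<open>tree_op\<close>.\<close>

lemma ell2_closure_truncate:
  assumes S: "\<And>K x. x \<in> ell2 \<Longrightarrow> truncate_seq K x \<in> S"
  shows "ell2.mtopology closure_of S = carrier ell2_module"
proof -
  have "\<exists>y\<in>S. y \<in> ell2.mball x \<epsilon>" if x: "x \<in> ell2" and "\<epsilon> > 0" for x \<epsilon>
  proof -
    define f where "f = (\<lambda>m. (cmod (x m))\<^sup>2)"
    have sf: "summable f"
      using x by (simp add: f_def ell2_def)
    obtain K where K: "norm (\<Sum>m. f (m + K)) < \<epsilon>\<^sup>2"
      using suminf_exist_split[OF _ sf, of "\<epsilon>\<^sup>2"] \<open>\<epsilon> > 0\<close> by auto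
    have "(\<Sum>m. (cmod (x m - truncate_seq K x m))\<^sup>2)
        = (\<Sum>m. (cmod (x (m + K) - truncate_seq K x (m + K)))\<^sup>2)
          + (\<Sum>m<K. (cmod (x m - truncate_seq K x m))\<^sup>2)"
      using ell2_diff[OF x truncate_seq_in_ell2[of K x]]
      by (intro suminf_split_initial_segment) (simp add: ell2_def)
    also have "\<dots> = (\<Sum>m. f (m + K))"
      by (simp add: truncate_seq_def f_def)
    also have "\<dots> < \<epsilon>\<^sup>2"
      using K by simp
    finally have "ip_dist ell2_module ell2_ip x (truncate_seq K x) < \<epsilon>"
      using x \<open>\<epsilon> > 0\<close> by (simp add: ell2_dist_eq real_less_lsqrt)
    then show ?thesis
      using S[OF x, of K] x unfolding ell2.in_mball
      by (intro bexI[of _ "truncate_seq K x"]) auto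
  qed
  then show ?thesis
    unfolding ell2.metric_closure_of by auto
qed

lemma ell2_finsum:
  assumes "finite F" "\<And>b. b \<in> F \<Longrightarrow> f b \<in> ell2"
  shows "finsum ell2_module f F = (\<lambda>m. \<Sum>b\<in>F. f b m)"
  using assms by (induction rule: finite_induct) (auto simp: ell2.M.finsum_insert)

lemma hilbert_base_ell2: "hilbert_base ell2_module ell2_ip (range unit_seq)"
  unfolding hilbert_base_def
proof (intro conjI ballI)
  show "range unit_seq \<subseteq> carrier ell2_module"
    by auto
  show "ell2_ip b b' = (if b = b' then 1 else 0)"
    if "b \<in> range unit_seq" "b' \<in> range unit_seq" for b b'
    using that by (auto simp: ell2_ip_unit_seq_left inj_eq[OF inj_unit_seq]) (auto simp: unit_seq_def)
  have "truncate_seq K x \<in> linear_span ell2_module (range unit_seq)" if "x \<in> ell2" for K x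
  proof -
    \<comment> \<open>\<open>linear_span\<close> indexes coefficients by the vectors themselves, so
      the index of a vector is recovered by inverting \<open>unit_seq\<close>.\<close>
    define c where "c = (\<lambda>b. x (inv_into UNIV unit_seq b))"
    have "finsum ell2_module (\<lambda>b. c b \<odot>\<^bsub>ell2_module\<^esub> b) (unit_seq ` {..<K})
        = (\<lambda>m. \<Sum>b\<in>unit_seq ` {..<K}. c b * b m)"
      by (subst ell2_finsum) (auto simp: ell2_smult)
    also have "\<dots> = (\<lambda>m. \<Sum>j<K. x j * unit_seq j m)"
      by (simp add: sum.reindex inj_on_subset[OF inj_unit_seq] c_def inj_unit_seq)
    also have "\<dots> = truncate_seq K x"
      by (auto simp: truncate_seq_def unit_seq_def if_distrib[of "(*) _"] sum.delta' cong: if_cong)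
    finally show ?thesis
      unfolding linear_span_def by (intro CollectI exI[of _ "unit_seq ` {..<K}"] exI[of _ c]) auto
  qed
  then show "ell2.mtopology closure_of linear_span ell2_module (range unit_seq) = carrier ell2_module"
    by (rule ell2_closure_truncate)
qed

lemma ell2_bounded_imp_continuous:
  assumes maps: "\<And>x. x \<in> ell2 \<Longrightarrow> T x \<in> ell2"
    and diff: "\<And>x y. x \<in> ell2 \<Longrightarrow> y \<in> ell2 \<Longrightarrow> T (\<lambda>m. x m - y m) = (\<lambda>m. T x m - T y m)"
    and bound: "\<And>x. x \<in> ell2 \<Longrightarrow> ip_norm ell2_ip (T x) \<le> M * ip_norm ell2_ip x"
    and "M > 0"
  shows "continuous_map ell2.mtopology ell2.mtopology T"
  unfolding ell2.metric_continuous_map[OF ell2.Metric_space_axioms]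
proof (intro conjI ballI allI impI)
  show "T ` carrier ell2_module \<subseteq> carrier ell2_module"
    using maps by auto
  fix a and \<epsilon> :: real
  assume a: "a \<in> carrier ell2_module" and "\<epsilon> > 0"
  have "ip_dist ell2_module ell2_ip (T a) (T x) < \<epsilon>"
    if "x \<in> ell2" "ip_dist ell2_module ell2_ip a x < \<epsilon> / M" for x
  proof -
    have "ip_dist ell2_module ell2_ip (T a) (T x) \<le> M * ip_dist ell2_module ell2_ip a x"
      using bound[of "\<lambda>m. a m - x m"] a that maps
      by (simp add: ip_dist_def ell2_minus ell2_diff diff)
    also have "\<dots> < \<epsilon>"
      using that \<open>M > 0\<close> by (simp add: field_simps)
    finally show ?thesis .
  qed
  then show "\<exists>\<delta>>0. \<forall>x. x \<in> carrier ell2_module \<and> ip_dist ell2_module ell2_ip a x < \<delta> \<longrightarrow>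
      ip_dist ell2_module ell2_ip (T a) (T x) < \<epsilon>"
    using divide_pos_pos[OF \<open>\<epsilon> > 0\<close> \<open>M > 0\<close>]
    by (intro exI[of _ "\<epsilon> / M"] conjI allI impI) simp_all
qed

section \<open>An operator on a tree with branches of every finite length\<close>

text \<open>Index 0 is the root, and \<open>idx n i\<close> is position \<open>i\<close> on branch \<open>n\<close>.\<close>

definition idx :: "nat \<Rightarrow> nat \<Rightarrow> nat" where
  "idx n i = Suc (prod_encode (n, i))"

lemma idx_simps [simp]: "idx n i \<noteq> 0" "0 \<noteq> idx n i" "idx n i = idx n' i' \<longleftrightarrow> n = n' \<and> i = i'"
  by (auto simp: idx_def inj_eq[OF inj_prod_encode])

lemma idx_cases:
  obtains "m = 0" | n i where "m = idx n i"
  unfolding idx_def by (metis not0_implies_Suc prod_decode_inverse surj_pair)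

text \<open>This makes each branch a subsequence of all indices, along which limits and sums can be
  taken.\<close>

lemma strict_mono_idx: "strict_mono (idx n)"
  by (simp add: strict_mono_Suc_iff idx_def prod_encode_def)

text \<open>The root is sent to itself, which keeps the map injective; by injectivity, shifting
  along the branches does not increase sums of squares.\<close>

definition next_idx :: "nat \<Rightarrow> nat" where
  "next_idx m = (case m of 0 \<Rightarrow> 0 | Suc k \<Rightarrow> (case prod_decode k of (n, i) \<Rightarrow> idx n (Suc i)))"

lemma next_idx_simps [simp]: "next_idx 0 = 0" "next_idx (idx n i) = idx n (Suc i)"
  by (simp_all add: next_idx_def idx_def)

lemma inj_next_idx: "inj next_idx"
proof (rule injI)
  show "m = m'" if "next_idx m = next_idx m'" for m m'
    using that by (cases m rule: idx_cases; cases m' rule: idx_cases) auto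
qed

text \<open>Every branch enters the root coordinate with a nonzero weight, while the geometric decay
  makes this coordinate a continuous functional.\<close>

definition root_weights :: "nat \<Rightarrow> complex" where
  "root_weights m = (if \<exists>n. m = idx n 0 then 1 / 2 ^ m else 0)"

lemma root_weights_simps [simp]:
  "root_weights 0 = 0"
  "root_weights (idx n 0) = 1 / 2 ^ idx n 0"
  "root_weights (idx n (Suc i)) = 0"
  by (auto simp: root_weights_def)

lemma root_weights_in_ell2 [simp]: "root_weights \<in> ell2"
  unfolding ell2_def mem_Collect_eq
  by (rule summable_comparison_test'[where N = 0, OF summable_geometric[of "1 / 4 :: real"]])
    (auto simp: root_weights_def norm_divide norm_power power_divide power2_eq_square
      power_mult_distrib[symmetric])

text \<open>
  On branch \<open>n\<close> the operator shifts the positions \<open>0, \<dots>, n\<close> down towards the root. The positions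
  beyond \<open>n\<close> carry an operator with dense range whose kernel is spanned by the sequence
  \<open>1 / 2 ^ i\<close>, which is not in its range; the shift sends this kernel to position \<open>n\<close>. This makes
  the range dense without prolonging any backward orbit of the root.
\<close>

definition tree_op :: "(nat \<Rightarrow> complex) \<Rightarrow> nat \<Rightarrow> complex" where
  "tree_op x m =
     (case m of 0 \<Rightarrow> ell2_ip x root_weights
      | Suc k \<Rightarrow> (case prod_decode k of (n, i) \<Rightarrow>
          if i \<le> n then x (idx n (Suc i)) else (x (idx n i) - 2 * x (idx n (Suc i))) / 2 ^ i))"

lemma tree_op_simps:
  "tree_op x 0 = ell2_ip x root_weights"
  "tree_op x (idx n i) =
     (if i \<le> n then x (idx n (Suc i)) else (x (idx n i) - 2 * x (idx n (Suc i))) / 2 ^ i)"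
  by (simp_all add: tree_op_def idx_def)

section \<open>Linearity and boundedness of the operator\<close>

lemma tree_op_add:
  assumes "x \<in> ell2" "y \<in> ell2"
  shows "tree_op (\<lambda>m. x m + y m) = (\<lambda>m. tree_op x m + tree_op y m)"
proof
  fix m
  show "tree_op (\<lambda>m. x m + y m) m = tree_op x m + tree_op y m"
    using assms ell2.ip_add_left[of x y root_weights]
    by (cases m rule: idx_cases) (auto simp: tree_op_simps field_simps)
qed

lemma tree_op_smult:
  assumes "x \<in> ell2"
  shows "tree_op (\<lambda>m. c * x m) = (\<lambda>m. c * tree_op x m)"
proof
  fix m
  show "tree_op (\<lambda>m. c * x m) m = c * tree_op x m"
    using assms ell2.ip_smult_left[of x root_weights c]
    by (cases m rule: idx_cases) (auto simp: tree_op_simps field_simps)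
qed

lemma tree_op_diff:
  assumes "x \<in> ell2" "y \<in> ell2"
  shows "tree_op (\<lambda>m. x m - y m) = (\<lambda>m. tree_op x m - tree_op y m)"
  using tree_op_add[of x "\<lambda>m. (-1) * y m"] tree_op_smult[of y "-1"] assms
  by (simp add: ell2_uminus)

text \<open>Off the root, a squared coordinate of the image is at most 2 times the squared
  coordinate at \<open>m\<close> plus 8 times that at \<open>next_idx m\<close>; since
  \<open>next_idx\<close> is injective, these sum to the 10 of the bound. The root coordinate is
  handled by the Cauchy-Schwarz inequality.\<close>

lemma tree_op_bound:
  assumes x: "x \<in> ell2"
  shows "tree_op x \<in> ell2"
    and "ip_norm ell2_ip (tree_op x)
           \<le> sqrt (10 + (ip_norm ell2_ip root_weights)\<^sup>2) * ip_norm ell2_ip x"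
proof -
  define f where "f = (\<lambda>m. (cmod (x m))\<^sup>2)"
  define g where "g = (\<lambda>m::nat. if m = 0 then (cmod (tree_op x 0))\<^sup>2 else 0)"
  have sf: "summable f"
    using x by (simp add: f_def ell2_def)
  have sh: "summable (f \<circ> next_idx)" and h: "suminf (f \<circ> next_idx) \<le> suminf f"
    using summable_reindex[OF sf inj_next_idx] suminf_reindex_mono[OF sf inj_next_idx]
    by (simp_all add: f_def)
  have g: "g sums (cmod (tree_op x 0))\<^sup>2"
    using sums_single[of 0 "\<lambda>m. (cmod (tree_op x 0))\<^sup>2"] by (simp add: g_def)
  have le: "(cmod (tree_op x m))\<^sup>2 \<le> g m + (2 * f m + 8 * (f \<circ> next_idx) m)" for m
  proof (cases m rule: idx_cases)
    case 1
    then show ?thesis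
      by (simp add: g_def f_def)
  next
    case (2 n i)
    have "(cmod ((x (idx n i) - 2 * x (idx n (Suc i))) / 2 ^ i))\<^sup>2
        \<le> (cmod (x (idx n i) + - 2 * x (idx n (Suc i))))\<^sup>2"
      by (intro power_mono) (simp_all add: norm_divide norm_power divide_le_eq mult_left_le_one_le
          mult_le_cancel_left1)
    also have "\<dots> \<le> 2 * f m + 8 * f (next_idx m)"
      using norm_add_sq_le[of "x (idx n i)" "- 2 * x (idx n (Suc i))"] 2
      by (simp add: f_def norm_mult power_mult_distrib)
    finally have A: "(cmod ((x (idx n i) - 2 * x (idx n (Suc i))) / 2 ^ i))\<^sup>2
        \<le> 2 * f m + 8 * f (next_idx m)" .
    have B: "(cmod (x (idx n (Suc i))))\<^sup>2 \<le> 2 * f m + 8 * f (next_idx m)"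
      using 2 by (simp add: f_def)
    show ?thesis
      using A B by (simp add: 2 g_def tree_op_simps(2))
  qed
  have sG: "(\<lambda>m. g m + (2 * f m + 8 * (f \<circ> next_idx) m)) sums
      ((cmod (tree_op x 0))\<^sup>2 + (2 * suminf f + 8 * suminf (f \<circ> next_idx)))"
    by (intro sums_add sums_mult g summable_sums sf sh)
  have sT: "summable (\<lambda>m. (cmod (tree_op x m))\<^sup>2)"
    by (rule summable_comparison_test'[where N = 0, OF sums_summable[OF sG]]) (use le in simp)
  then show T: "tree_op x \<in> ell2"
    by (simp add: ell2_def)
  have "0 \<le> suminf f"
    by (rule suminf_nonneg[OF sf]) (simp add: f_def)
  then have xx: "suminf f = (ip_norm ell2_ip x)\<^sup>2"
    unfolding f_def ell2_norm_eq[OF x] by simp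
  have "(\<Sum>m. (cmod (tree_op x m))\<^sup>2)
      \<le> (cmod (tree_op x 0))\<^sup>2 + (2 * suminf f + 8 * suminf (f \<circ> next_idx))"
    using suminf_le[OF le sT sums_summable[OF sG]] sums_unique[OF sG] by simp
  also have "\<dots> \<le> (ip_norm ell2_ip x * ip_norm ell2_ip root_weights)\<^sup>2 + 10 * suminf f"
    using h power_mono[OF ell2.Cauchy_Schwarz[of x root_weights] norm_ge_zero, of 2] x
    by (simp add: tree_op_simps)
  also have "\<dots> = (10 + (ip_norm ell2_ip root_weights)\<^sup>2) * (ip_norm ell2_ip x)\<^sup>2"
    by (simp add: xx algebra_simps)
  finally have sq: "(\<Sum>m. (cmod (tree_op x m))\<^sup>2)
      \<le> (10 + (ip_norm ell2_ip root_weights)\<^sup>2) * (ip_norm ell2_ip x)\<^sup>2" .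
  have "0 \<le> ip_norm ell2_ip x"
    using ell2.ip_nonneg[of x] x by (simp add: ip_norm_def)
  then show "ip_norm ell2_ip (tree_op x)
      \<le> sqrt (10 + (ip_norm ell2_ip root_weights)\<^sup>2) * ip_norm ell2_ip x"
    unfolding ell2_norm_eq[OF T]
    using sq by (intro real_le_lsqrt) (simp_all add: power_mult_distrib add_nonneg_nonneg)
qed

lemma linear_tree_op: "linear_self_map ell2_module tree_op"
  by (auto simp: linear_self_map_def tree_op_bound tree_op_add tree_op_smult)

lemma continuous_tree_op: "continuous_map ell2.mtopology ell2.mtopology tree_op"
proof (rule ell2_bounded_imp_continuous)
  show "0 < sqrt (10 + (ip_norm ell2_ip root_weights)\<^sup>2)"
    by (simp add: add_pos_nonneg)
qed (fact tree_op_bound tree_op_diff)+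

section \<open>Images of coordinate vectors and density of the range\<close>

lemma tree_op_unit_idx_0:
  "tree_op (unit_seq (idx n 0)) = (\<lambda>m. root_weights (idx n 0) * unit_seq 0 m)"
proof
  show "tree_op (unit_seq (idx n 0)) m = root_weights (idx n 0) * unit_seq 0 m" for m
    by (cases m rule: idx_cases) (auto simp: tree_op_simps ell2_ip_unit_seq_left unit_seq_def)
qed

lemma tree_op_unit_idx_Suc:
  assumes "i < n"
  shows "tree_op (unit_seq (idx n (Suc i))) = unit_seq (idx n i)"
proof
  show "tree_op (unit_seq (idx n (Suc i))) m = unit_seq (idx n i) m" for m
    using assms
    by (cases m rule: idx_cases) (auto simp: tree_op_simps ell2_ip_unit_seq_left unit_seq_def)
qed

lemma tree_op_unit_idx_beyond:
  assumes "n \<le> i"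
  shows "tree_op (unit_seq (idx n (Suc i))) =
    (\<lambda>m. (if i = n then 1 else - 2 / 2 ^ i) * unit_seq (idx n i) m
       + 1 / 2 ^ Suc i * unit_seq (idx n (Suc i)) m)"
proof
  show "tree_op (unit_seq (idx n (Suc i))) m =
      (if i = n then 1 else - 2 / 2 ^ i) * unit_seq (idx n i) m
       + 1 / 2 ^ Suc i * unit_seq (idx n (Suc i)) m" for m
    using assms
    by (cases m rule: idx_cases) (auto simp: tree_op_simps ell2_ip_unit_seq_left unit_seq_def)
qed

text \<open>The kernel vector of the operator on the positions of branch \<open>n\<close> beyond
  \<open>n\<close>. The sum has at most one term, because \<open>idx n\<close> is injective; this
  form spares decoding \<open>m\<close>.\<close>

definition geometric_tail :: "nat \<Rightarrow> nat \<Rightarrow> complex" where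
  "geometric_tail n m = (\<Sum>i\<in>{i. n < i \<and> m = idx n i}. 1 / 2 ^ i)"

lemma geometric_tail_simps:
  "geometric_tail n 0 = 0"
  "geometric_tail n (idx n' i) = (if n' = n \<and> n < i then 1 / 2 ^ i else 0)"
proof -
  show "geometric_tail n 0 = 0"
    by (simp add: geometric_tail_def)
  have "{j. n < j \<and> idx n' i = idx n j} = (if n' = n \<and> n < i then {i} else {})"
    by auto
  then show "geometric_tail n (idx n' i) = (if n' = n \<and> n < i then 1 / 2 ^ i else 0)"
    by (simp add: geometric_tail_def)
qed

lemma geometric_tail_in_ell2: "geometric_tail n \<in> ell2"
proof -
  have "(cmod (geometric_tail n m))\<^sup>2 = 0" if "m \<notin> range (idx n)" for m
    using that by (cases m rule: idx_cases) (auto simp: geometric_tail_simps)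
  moreover have "summable (\<lambda>i. (cmod (geometric_tail n (idx n i)))\<^sup>2)"
    by (rule summable_comparison_test'[where N = 0, OF summable_geometric[of "1 / 4 :: real"]])
      (auto simp: geometric_tail_simps norm_divide norm_power power_divide power2_eq_square
        power_mult_distrib[symmetric])
  ultimately show ?thesis
    using summable_mono_reindex[OF strict_mono_idx, where f = "\<lambda>m. (cmod (geometric_tail n m))\<^sup>2"]
    by (simp add: ell2_def)
qed

lemma tree_op_geometric_tail:
  "tree_op (geometric_tail n) = (\<lambda>m. 1 / 2 ^ Suc n * unit_seq (idx n n) m)"
proof
  fix m
  have "geometric_tail n j * cnj (root_weights j) = 0" for j
    by (cases j rule: idx_cases) (auto simp: geometric_tail_simps root_weights_def)
  then have "ell2_ip (geometric_tail n) root_weights = 0"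
    unfolding ell2_ip_def by (simp only: suminf_zero)
  then show "tree_op (geometric_tail n) m = 1 / 2 ^ Suc n * unit_seq (idx n n) m"
    by (cases m rule: idx_cases) (auto simp: tree_op_simps geometric_tail_simps unit_seq_def)
qed

lemma range_tree_op_add:
  "y \<in> tree_op ` ell2 \<Longrightarrow> z \<in> tree_op ` ell2 \<Longrightarrow> (\<lambda>m. y m + z m) \<in> tree_op ` ell2"
  by (auto simp: tree_op_add[symmetric] intro!: imageI ell2_add)

lemma range_tree_op_smult: "y \<in> tree_op ` ell2 \<Longrightarrow> (\<lambda>m. c * y m) \<in> tree_op ` ell2"
  by (auto simp: tree_op_smult[symmetric] intro!: imageI ell2_smult)

text \<open>The root and the positions before \<open>n\<close> are, up to a scalar, images of the
  next position. Position \<open>n\<close> comes from the geometric tail. Beyond \<open>n\<close>,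
  the image of a coordinate vector combines it with its predecessor, which is in the range by
  induction.\<close>

lemma unit_seq_in_range_tree_op: "unit_seq m \<in> tree_op ` ell2"
proof (cases m rule: idx_cases)
  case 1
  have "(\<lambda>j. 2 ^ idx 0 0 * tree_op (unit_seq (idx 0 0)) j) \<in> tree_op ` ell2"
    by (intro range_tree_op_smult imageI) simp
  then show ?thesis
    by (simp add: tree_op_unit_idx_0 1)
next
  case (2 n i)
  have beyond: "unit_seq (idx n (n + k)) \<in> tree_op ` ell2" for k
  proof (induction k)
    case 0
    have "(\<lambda>j. 2 ^ Suc n * tree_op (geometric_tail n) j) \<in> tree_op ` ell2"
      by (intro range_tree_op_smult imageI geometric_tail_in_ell2)
    then show ?case
      by (simp add: tree_op_geometric_tail)
  next
    case (Suc k)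
    define i where "i = n + k"
    \<comment> \<open>The coefficient of the predecessor in the image of
      \<open>unit_seq (idx n (Suc i))\<close>; subtracting this part and rescaling leaves the vector
      itself.\<close>
    define \<beta> :: complex where "\<beta> = (if i = n then 1 else - 2 / 2 ^ i)"
    have "(\<lambda>j. 2 ^ Suc i * (tree_op (unit_seq (idx n (Suc i))) j
             + - \<beta> * unit_seq (idx n i) j)) \<in> tree_op ` ell2"
      using Suc by (intro range_tree_op_smult range_tree_op_add imageI) (simp_all add: i_def)
    also have "(\<lambda>j. 2 ^ Suc i * (tree_op (unit_seq (idx n (Suc i))) j
             + - \<beta> * unit_seq (idx n i) j)) = unit_seq (idx n (Suc i))"
      by (subst tree_op_unit_idx_beyond) (auto simp: i_def \<beta>_def)
    finally show ?case
      by (simp add: i_def)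
  qed
  show ?thesis
  proof (cases "i < n")
    case True
    then have "unit_seq m = tree_op (unit_seq (idx n (Suc i)))"
      by (simp add: 2 tree_op_unit_idx_Suc)
    then show ?thesis
      by simp
  next
    case False
    then show ?thesis
      using beyond[of "i - n"] by (simp add: 2)
  qed
qed

lemma dense_range_tree_op: "ell2.mtopology closure_of (tree_op ` ell2) = carrier ell2_module"
proof (rule ell2_closure_truncate)
  show "truncate_seq K x \<in> tree_op ` ell2" for K x
  proof (induction K)
    case 0
    have "tree_op (\<lambda>m. 0) = truncate_seq 0 x"
      using tree_op_smult[of "\<lambda>m. 0" 0] by (simp add: truncate_seq_def fun_eq_iff)
    then show ?case
      by (metis ell2_zero imageI)
  next
    case (Suc K)
    have "truncate_seq (Suc K) x = (\<lambda>m. truncate_seq K x m + x K * unit_seq K m)"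
      by (auto simp: truncate_seq_def unit_seq_def less_Suc_eq)
    then show ?case
      by (simp only:) (intro range_tree_op_add range_tree_op_smult Suc unit_seq_in_range_tree_op)
  qed
qed

section \<open>Finite and infinite backward orbits of the root\<close>

lemma root_in_attracting_set: "unit_seq 0 \<in> attracting_set ell2 tree_op"
  unfolding attracting_set_def
proof (rule INT_I)
  have chain: "(tree_op ^^ k) (\<lambda>m. c * unit_seq (idx n k) m) = (\<lambda>m. c * unit_seq (idx n 0) m)"
    if "k \<le> n" for n k c
    using that
  proof (induction k)
    case (Suc k)
    then show ?case
      by (simp add: funpow_Suc_right tree_op_smult tree_op_unit_idx_Suc del: funpow.simps)
  qed simp
  fix N
  show "unit_seq 0 \<in> (tree_op ^^ N) ` ell2"
  proof (cases N)
    \<comment> \<open>Position \<open>n\<close> of branch \<open>n\<close> is moved to position 0 in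
      \<open>n\<close> steps and to the root in one more; the scalar \<open>2 ^ idx n 0\<close>
      cancels the root weight.\<close>
    case (Suc n)
    define x where "x = (\<lambda>m. 2 ^ idx n 0 * unit_seq (idx n n) m)"
    have "(tree_op ^^ N) x = unit_seq 0"
      by (simp add: Suc x_def chain tree_op_smult tree_op_unit_idx_0)
    moreover have "x \<in> ell2"
      by (simp add: x_def ell2_smult)
    ultimately show ?thesis
      by (metis imageI)
  qed simp
qed

text \<open>On branch \<open>n\<close>, all members of a backward orbit vanish beyond position
  \<open>n\<close>. The shift then carries these zeros down to position 0, so the root coordinate of
  the first member is 0 instead of 1.\<close>

lemma root_not_in_stable_set: "unit_seq 0 \<notin> stable_set ell2 tree_op"
proof
  assume "unit_seq 0 \<in> stable_set ell2 tree_op"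
  then obtain s where s: "\<And>k. s k \<in> ell2" and s0: "s 0 = unit_seq 0"
    and step: "\<And>k. tree_op (s (Suc k)) = s k"
    unfolding stable_set_def by blast
  have tail: "s k (idx n i) = 0" if "n < i" for k n i
    using that
  proof (induction k arbitrary: i)
    case 0
    then show ?case
      by (simp add: s0 unit_seq_def)
  next
    case (Suc k)
    have halve: "s (Suc k) (idx n j) = 2 * s (Suc k) (idx n (Suc j))" if "n < j" for j
      using Suc.IH[OF that] that by (simp add: step[symmetric, of k] tree_op_simps)
    \<comment> \<open>By the induction hypothesis the image of \<open>s (Suc k)\<close> vanishes
      beyond \<open>n\<close>, so there \<open>s (Suc k)\<close> is \<open>C\<close> times the
      geometric sequence.\<close>
    define C where "C = 2 ^ i * s (Suc k) (idx n i)"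
    have geo: "2 ^ (i + j) * s (Suc k) (idx n (i + j)) = C" for j
    proof (induction j)
      case (Suc j)
      then show ?case
        using halve[of "i + j"] \<open>n < i\<close> by (simp add: mult_ac)
    qed (simp add: C_def)
    \<comment> \<open>One step further back: a preimage of \<open>C / 2 ^ j\<close> would have
      constant differences \<open>C\<close>, whereas its coordinates tend to 0.\<close>
    define z where "z = s (Suc (Suc k))"
    have "z (idx n (i + j)) - 2 * z (idx n (Suc (i + j))) = C" for j
    proof -
      have "s (Suc k) (idx n (i + j)) = (z (idx n (i + j)) - 2 * z (idx n (Suc (i + j)))) / 2 ^ (i + j)"
        using \<open>n < i\<close> by (simp add: step[symmetric, of "Suc k"] tree_op_simps z_def)
      then show ?thesis
        using geo[of j] by simp
    qed
    then have "(\<lambda>j. z (idx n (i + j)) - 2 * z (idx n (Suc (i + j)))) = (\<lambda>j. C)"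
      by blast
    moreover have "(\<lambda>j. z (idx n (i + j)) - 2 * z (idx n (Suc (i + j)))) \<longlonglongrightarrow> 0 - 2 * 0"
    proof (intro tendsto_intros)
      have "(\<lambda>j. z (idx n j)) \<longlonglongrightarrow> 0"
        using LIMSEQ_subseq_LIMSEQ[OF ell2_tendsto_0[OF s] strict_mono_idx]
        by (simp add: z_def o_def)
      from LIMSEQ_ignore_initial_segment[OF this, of i] LIMSEQ_ignore_initial_segment[OF this, of "Suc i"]
      show "(\<lambda>j. z (idx n (i + j))) \<longlonglongrightarrow> 0" "(\<lambda>j. z (idx n (Suc (i + j)))) \<longlonglongrightarrow> 0"
        by (simp_all add: add.commute)
    qed
    ultimately have "C = 0"
      by (simp add: LIMSEQ_const_iff)
    then show ?case
      by (simp add: C_def)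
  qed
  \<comment> \<open>For \<open>i \<le> n\<close>, raising both the time and the position by one
    keeps the coordinate; this leads to position \<open>Suc n\<close>, where it vanishes.\<close>
  have "s k (idx n i) = 0" for k n i
  proof (cases "n < i")
    case False
    then have "i \<le> Suc n"
      by simp
    then show ?thesis
    proof (induction i arbitrary: k rule: inc_induct)
      case base
      show ?case
        by (rule tail) simp
    next
      case (step i)
      have "s k (idx n i) = s (Suc k) (idx n (Suc i))"
        using step.hyps by (simp add: \<open>\<And>k. tree_op (s (Suc k)) = s k\<close>[symmetric, of k] tree_op_simps)
      then show ?case
        using step.IH by simp
    qed
  qed (rule tail)
  then have "s 1 j * cnj (root_weights j) = 0" for j
    by (cases j rule: idx_cases) auto
  then have "ell2_ip (s 1) root_weights = 0"
    unfolding ell2_ip_def by (simp only: suminf_zero)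
  then have "s 0 0 = 0"
    unfolding step[symmetric, of 0] by (simp add: tree_op_simps(1))
  then show False
    by (simp add: s0 unit_seq_def)
qed

section \<open>A self-map of the upper half-plane without backward orbits\<close>

text \<open>The decay beats both the spacing of the poles, of order \<open>(1 / 2) ^ j\<close>, and
  the radius \<open>(1 / 4) ^ (j + 4)\<close> of the disc outside which the \<open>j\<close>-th term
  is negligible; both quotients have small sums.\<close>

definition mass :: "nat \<Rightarrow> real" where
  "mass j = (1 / 8) ^ (j + 3)"

text \<open>
  The poles of \<open>pole_sum\<close> are repelling fixed points of \<open>halfplane_map\<close> just below the real axis; a
  backward orbit converging to the \<open>k\<close>-th one leaves the half-plane, but by the choice of
  the depth only after more than \<open>k\<close> steps.
\<close>

definition depth :: "nat \<Rightarrow> real" where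
  "depth j = mass j ^ Suc j / 8"

definition pole :: "nat \<Rightarrow> complex" where
  "pole j = Complex ((1 / 2) ^ j) (- depth j)"

definition pole_term :: "nat \<Rightarrow> complex \<Rightarrow> complex" where
  "pole_term j z = \<i> * of_real (mass j) / (z - pole j)"

definition pole_sum :: "complex \<Rightarrow> complex" where
  "pole_sum z = 1 + (\<Sum>j. pole_term j z)"

text \<open>Near \<open>pole k\<close> the increment \<open>\<i> / pole_sum z\<close> is close to
  \<open>(z - pole k) / mass k\<close>, so the extended map has a fixed point there with multiplier
  \<open>1 + 1 / mass k\<close>.\<close>

definition halfplane_map :: "complex \<Rightarrow> complex" where
  "halfplane_map z = z + \<i> / pole_sum z"

section \<open>Holomorphy of the map and growth of the imaginary part\<close>

lemma mass_pos: "0 < mass j"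
  by (simp add: mass_def)

lemma mass_le: "mass j \<le> 1 / 512"
proof -
  have "(1 / 8 :: real) ^ j \<le> 1"
    by (simp add: power_le_one)
  then show ?thesis
    by (simp add: mass_def power_add power3_eq_cube)
qed

lemma depth_pos: "0 < depth j"
  by (simp add: depth_def mass_pos)

lemma pole_simps [simp]: "Re (pole j) = (1 / 2) ^ j" "Im (pole j) = - depth j"
  by (simp_all add: pole_def)

lemma summable_mass: "summable mass"
  unfolding mass_def power_add by (intro summable_mult2 summable_geometric) simp

lemma norm_pole_term: "norm (pole_term j z) = mass j / norm (z - pole j)"
  using mass_pos[of j] by (simp add: pole_term_def norm_divide norm_mult)

lemma Im_le_norm_diff_pole: "Im z + depth j \<le> norm (z - pole j)"
  using abs_Im_le_cmod[of "z - pole j"] by simp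

lemma norm_pole_term_le:
  assumes "0 < d" "d \<le> Im z"
  shows "norm (pole_term j z) \<le> mass j / d"
proof -
  have "d \<le> norm (z - pole j)"
    using Im_le_norm_diff_pole[of z j] depth_pos[of j] assms by simp
  then show ?thesis
    unfolding norm_pole_term using mass_pos[of j] assms by (intro frac_le) auto
qed

lemma summable_norm_pole_term:
  assumes "0 < Im z"
  shows "summable (\<lambda>j. norm (pole_term j z))"
  by (rule summable_comparison_test'[where N = 0, OF summable_divide[OF summable_mass, of "Im z"]])
    (use norm_pole_term_le[OF assms] in simp)

lemma Re_pole_term: "0 < Im z \<Longrightarrow> 0 \<le> Re (pole_term j z)"
  using mass_pos[of j] depth_pos[of j]
  by (simp add: pole_term_def Re_divide zero_le_divide_iff)

lemma Re_pole_sum: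
  assumes "0 < Im z"
  shows "1 \<le> Re (pole_sum z)"
proof -
  have s: "summable (\<lambda>j. pole_term j z)"
    by (rule summable_norm_cancel[OF summable_norm_pole_term[OF assms]])
  have "0 \<le> (\<Sum>j. Re (pole_term j z))"
    using assms by (intro suminf_nonneg summable_Re s Re_pole_term)
  then show ?thesis
    using bounded_linear.suminf[OF bounded_linear_Re s] by (simp add: pole_sum_def)
qed

lemma pole_sum_nonzero: "0 < Im z \<Longrightarrow> pole_sum z \<noteq> 0"
  using Re_pole_sum[of z] by auto

lemma holomorphic_pole_sum: "pole_sum holomorphic_on {z. 0 < Im z}"
proof -
  have "(\<lambda>z. \<Sum>j. pole_term j z) holomorphic_on {z. 0 < Im z}"
  proof (rule holomorphic_uniform_sequence)
    show "open {z. 0 < Im z}"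
      by (rule open_halfspace_Im_gt)
    have "z \<noteq> pole j" if "0 < Im z" for z j
      using that depth_pos[of j] by auto
    then show "(\<lambda>z. \<Sum>j<n. pole_term j z) holomorphic_on {z. 0 < Im z}" for n
      unfolding pole_term_def by (intro holomorphic_intros) auto
    fix z
    assume z: "z \<in> {z. 0 < Im z}"
    \<comment> \<open>Half the height of \<open>z\<close> keeps the disc above height
      \<open>d\<close>, where \<open>mass j / d\<close> is a majorant for the Weierstrass
      test.\<close>
    define d where "d = Im z / 2"
    have Im_ge: "d \<le> Im w" if "w \<in> cball z d" for w
    proof -
      have "\<bar>Im (z - w)\<bar> \<le> d"
        using that abs_Im_le_cmod[of "z - w"] by (simp add: dist_norm)
      then show ?thesis
        unfolding d_def minus_complex.sel by linarith
    qed
    have "0 < d"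
      using z by (simp add: d_def)
    have "uniform_limit (cball z d) (\<lambda>n w. \<Sum>j<n. pole_term j w) (\<lambda>w. \<Sum>j. pole_term j w)
        sequentially"
      by (rule Weierstrass_m_test[OF norm_pole_term_le summable_divide[OF summable_mass]])
        (use \<open>0 < d\<close> Im_ge in auto)
    moreover have "cball z d \<subseteq> {z. 0 < Im z}"
      using Im_ge \<open>0 < d\<close> by fastforce
    ultimately show "\<exists>d. 0 < d \<and> cball z d \<subseteq> {z. 0 < Im z} \<and>
        uniform_limit (cball z d) (\<lambda>n z. \<Sum>j<n. pole_term j z) (\<lambda>z. \<Sum>j. pole_term j z) sequentially"
      using \<open>0 < d\<close> by blast
  qed
  then show ?thesis
    unfolding pole_sum_def by (intro holomorphic_intros)
qed

lemma holomorphic_halfplane_map: "halfplane_map holomorphic_on {z. 0 < Im z}"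
  unfolding halfplane_map_def
  by (intro holomorphic_intros holomorphic_pole_sum) (simp add: pole_sum_nonzero)

text \<open>The increment \<open>\<i> / c\<close> has imaginary part
  \<open>Re c / (norm c)\<^sup>2\<close>, and \<open>Re c\<close> is at least 1.\<close>

lemma Im_halfplane_map:
  assumes "0 < Im z"
  shows "Im z + 1 / (norm (pole_sum z))\<^sup>2 \<le> Im (halfplane_map z)"
proof -
  define c where "c = pole_sum z"
  have "1 \<le> Re c"
    using Re_pole_sum[OF assms] by (simp add: c_def)
  have "1 / (norm c)\<^sup>2 \<le> Re c / (norm c)\<^sup>2"
    using \<open>1 \<le> Re c\<close> by (intro divide_right_mono) auto
  also have "\<dots> = Im (\<i> / c)"
    by (simp add: Im_divide cmod_power2)
  finally show ?thesis
    by (simp add: halfplane_map_def c_def)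
qed

lemma halfplane_map_in: "0 < Im z \<Longrightarrow> 0 < Im (halfplane_map z)"
  by (rule less_le_trans[OF add_pos_nonneg Im_halfplane_map]) simp_all

text \<open>The squared step length is exactly the lower bound for the gain in height, and the
  height before the step is positive.\<close>

lemma halfplane_map_step:
  assumes "0 < Im z"
  shows "(norm (halfplane_map z - z))\<^sup>2 \<le> Im (halfplane_map z)"
  using Im_halfplane_map[OF assms] assms
  by (simp add: halfplane_map_def norm_divide power_divide)

section \<open>Localisation at one pole and absence of infinite backward orbits\<close>

lemma half_powers_separated:
  assumes "j \<noteq> (k::nat)"
  shows "max ((1/2)^j) ((1/2)^k) / 2 \<le> \<bar>(1/2)^j - (1/2)^k :: real\<bar>"
proof -
  have *: "(1/2)^j \<le> (1/2)^i / (2::real)" if "i < j" for i j :: nat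
    using power_decreasing[of "Suc i" j "1/2 :: real"] that by simp
  have pos: "0 < (1/2 :: real)^i" for i :: nat
    by simp
  consider "j < k" | "k < j"
    using assms by linarith
  then show ?thesis
  proof cases
    case 1
    have "max ((1/2)^j) ((1/2)^k) = (1/2 :: real)^j"
      by (rule max_absorb1) (use *[OF 1] pos[of j] in linarith)
    then show ?thesis
      unfolding \<open>max _ _ = _\<close> using *[OF 1] pos[of j] pos[of k] by linarith
  next
    case 2
    have "max ((1/2)^j) ((1/2)^k) = (1/2 :: real)^k"
      by (rule max_absorb2) (use *[OF 2] pos[of k] in linarith)
    then show ?thesis
      unfolding \<open>max _ _ = _\<close> using *[OF 2] pos[of j] pos[of k] by linarith
  qed
qed

text \<open>In this vertical strip every other pole is at distance at least
  \<open>(1 / 2) ^ j / 4\<close>, so its term is at most \<open>(1 / 4) ^ j / 128\<close>; these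
  bounds sum to 1/96.\<close>

lemma pole_sum_near:
  assumes z: "0 < Im z" and near: "\<bar>Re z - (1 / 2) ^ k\<bar> \<le> (1 / 2) ^ k / 4"
  shows "norm (pole_sum z - 1 - pole_term k z) \<le> 1 / 64"
proof -
  define f where "f = (\<lambda>j. if j = k then 0 else pole_term j z)"
  have le: "norm (f j) \<le> (1 / 4) ^ j / 128" for j
  proof (cases "j = k")
    case False
    have "(1/2)^j / 4 \<le> \<bar>Re z - (1 / 2) ^ j\<bar>"
      using half_powers_separated[OF False] near by linarith
    also have "\<dots> \<le> norm (z - pole j)"
      using abs_Re_le_cmod[of "z - pole j"] by simp
    finally have "norm (pole_term j z) \<le> mass j / ((1/2)^j / 4)"
      unfolding norm_pole_term using mass_pos[of j] by (intro frac_le) auto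
    also have "\<dots> = (1 / 4) ^ j / 128"
      by (simp add: mass_def power_add power3_eq_cube power_divide power_mult_distrib[symmetric]
          field_simps)
    finally show ?thesis
      by (simp add: f_def False)
  qed (simp add: f_def)
  have s: "summable (\<lambda>j. pole_term j z)"
    by (rule summable_norm_cancel[OF summable_norm_pole_term[OF z]])
  have "(\<lambda>j. pole_term j z - (if j = k then pole_term j z else 0))
      sums ((\<Sum>j. pole_term j z) - pole_term k z)"
    by (intro sums_diff summable_sums s sums_single)
  moreover have "(\<lambda>j. pole_term j z - (if j = k then pole_term j z else 0)) = f"
    by (auto simp: f_def)
  ultimately have "suminf f = pole_sum z - 1 - pole_term k z"
    by (simp add: pole_sum_def sums_iff)
  moreover have "norm (suminf f) \<le> (\<Sum>j. (1 / 4) ^ j / 128)"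
    by (rule norm_suminf_le[OF le]) (intro summable_divide summable_geometric, simp)
  moreover have "(\<Sum>j. (1 / 4 :: real) ^ j / 128) = 1 / 96"
    by (subst suminf_divide) (auto simp: suminf_geometric)
  ultimately show ?thesis
    by simp
qed

text \<open>Outside all these discs the \<open>j\<close>-th term is at most
  \<open>(1 / 2) ^ j / 2\<close>, so the terms add at most 1 to the constant 1.\<close>

lemma near_some_pole:
  assumes z: "0 < Im z" and large: "2 < norm (pole_sum z)"
  shows "\<exists>j. norm (z - pole j) < (1 / 4) ^ (j + 4)"
proof (rule ccontr)
  assume "\<nexists>j. norm (z - pole j) < (1 / 4) ^ (j + 4)"
  then have far: "(1 / 4) ^ (j + 4) \<le> norm (z - pole j)" for j
    by (simp add: not_less)
  have "norm (pole_term j z) \<le> (1/2)^j / 2" for j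
  proof -
    have "norm (pole_term j z) \<le> mass j / (1 / 4) ^ (j + 4)"
      unfolding norm_pole_term using far[of j] mass_pos[of j] by (intro frac_le) auto
    also have "\<dots> = (1/2)^j / 2"
      by (simp add: mass_def power_add power_divide field_simps power_mult_distrib[symmetric])
    finally show ?thesis .
  qed
  then have "norm (\<Sum>j. pole_term j z) \<le> (\<Sum>j. (1/2)^j / 2)"
    by (rule norm_suminf_le) (intro summable_divide summable_geometric, simp)
  also have "(\<Sum>j. (1/2 :: real)^j / 2) = 1"
    by (subst suminf_divide) (auto simp: suminf_geometric)
  finally have "norm (pole_sum z) \<le> 2"
    using norm_triangle_ineq[of 1 "\<Sum>j. pole_term j z"] by (simp add: pole_sum_def)
  then show False
    using large by simp
qed

lemma quarter_power_le: "(1 / 4 :: real) ^ (k + 4) \<le> (1 / 2) ^ k / 256"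
proof -
  have "(1 / 4 :: real) ^ k \<le> (1 / 2) ^ k"
    by (rule power_mono) auto
  then show ?thesis
    by (simp add: power_add power_divide)
qed

text \<open>The image lies below height \<open>(1 / 4) ^ (k + 4)\<close>, so the step is shorter
  than \<open>(1 / 2) ^ (k + 4)\<close>, too short to bridge the gap between two poles.\<close>

lemma stays_near_pole:
  assumes w: "0 < Im w" and near: "norm (halfplane_map w - pole k) < (1 / 4) ^ (k + 4)"
    and near': "norm (w - pole j) < (1 / 4) ^ (j + 4)"
  shows "j = k"
proof (rule ccontr)
  assume "j \<noteq> k"
  define z where "z = halfplane_map w"
  have "(norm (z - w))\<^sup>2 \<le> Im z"
    using halfplane_map_step[OF w] by (simp add: z_def)
  also have "\<dots> \<le> norm (z - pole k)"
    using Im_le_norm_diff_pole[of z k] depth_pos[of k] by simp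
  also have "\<dots> \<le> ((1 / 2) ^ (k + 4))\<^sup>2"
    using near by (simp add: z_def power_mult[symmetric] power2_eq_square power_mult_distrib[symmetric])
  finally have step: "norm (z - w) \<le> (1 / 2) ^ k / 16"
    by (intro power2_le_imp_le[of "norm (z - w)"]) (simp_all add: power_add power_divide)
  have "max ((1/2)^j) ((1/2)^k) / 2 \<le> \<bar>Re (pole j - pole k)\<bar>"
    using half_powers_separated[OF \<open>j \<noteq> k\<close>] by simp
  also have "\<dots> \<le> norm (pole j - pole k)"
    by (rule abs_Re_le_cmod)
  also have "pole j - pole k = (z - pole k) - (z - w) - (w - pole j)"
    by simp
  also have "norm \<dots> \<le> norm (z - pole k) + norm (z - w) + norm (w - pole j)"
    by (meson norm_triangle_ineq4 order_trans add_right_mono)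
  also have "\<dots> \<le> (1/2)^k / 256 + (1/2)^k / 16 + (1/2)^j / 256"
    using near near' step quarter_power_le[of k] quarter_power_le[of j] by (simp add: z_def)
  finally have "max ((1/2)^j) ((1/2)^k) / 2 \<le> (1/2)^k / 256 + (1/2)^k / 16 + (1/2::real)^j / 256" .
  moreover have "0 < (1/2::real)^j" "0 < (1/2::real)^k"
    by simp_all
  ultimately show False
    using max.cobounded1[of "(1/2::real)^j" "(1/2)^k"] max.cobounded2[of "(1/2::real)^k" "(1/2)^j"]
    by linarith
qed

text \<open>Points of the half-plane keep distance \<open>depth k\<close> from the pole, which
  bounds its term; the other terms are negligible.\<close>

lemma pole_sum_bounded_near_pole:
  assumes z: "0 < Im z" and near: "norm (z - pole k) < (1 / 4) ^ (k + 4)"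
  shows "norm (pole_sum z) \<le> 2 + mass k / depth k"
proof -
  have "\<bar>Re z - (1 / 2) ^ k\<bar> \<le> norm (z - pole k)"
    using abs_Re_le_cmod[of "z - pole k"] by simp
  also have "\<dots> \<le> (1 / 2) ^ k / 256"
    using near quarter_power_le[of k] by linarith
  also have "\<dots> \<le> (1 / 2) ^ k / 4"
    by simp
  finally have "\<bar>Re z - (1 / 2) ^ k\<bar> \<le> (1 / 2) ^ k / 4" .
  from pole_sum_near[OF z this] have "norm (pole_sum z - 1 - pole_term k z) \<le> 1 / 64" .
  moreover have "norm (pole_term k z) \<le> mass k / depth k"
    unfolding norm_pole_term using Im_le_norm_diff_pole[of z k] z mass_pos[of k] depth_pos[of k]
    by (intro divide_left_mono mult_pos_pos) auto
  moreover have "norm (pole_sum z) \<le> norm (1 + pole_term k z) + norm (pole_sum z - 1 - pole_term k z)"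
    using norm_triangle_ineq[of "1 + pole_term k z" "pole_sum z - 1 - pole_term k z"] by simp
  moreover have "norm (1 + pole_term k z) \<le> 1 + norm (pole_term k z)"
    using norm_triangle_ineq[of 1 "pole_term k z"] by simp
  ultimately show ?thesis
    by simp
qed

lemma no_infinite_backward_orbit:
  assumes pos: "\<And>n. 0 < Im (s n)" and step: "\<And>n. halfplane_map (s (Suc n)) = s n"
  shows False
proof -
  have drop: "1 / (norm (pole_sum (s (Suc n))))\<^sup>2 \<le> Im (s n) - Im (s (Suc n))" for n
    using Im_halfplane_map[OF pos[of "Suc n"]] by (simp add: step)
  have "decseq (\<lambda>n. Im (s n))"
    using drop by (intro decseq_SucI) (meson diff_ge_0_iff_ge order_trans zero_le_divide_1_iff zero_le_power2)
  then obtain y where "(\<lambda>n. Im (s n)) \<longlonglongrightarrow> y"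
    using decseq_convergent[of "\<lambda>n. Im (s n)" 0] pos by (metis less_imp_le)
  then have lim: "(\<lambda>n. Im (s n) - Im (s (Suc n))) \<longlonglongrightarrow> 0"
    using tendsto_diff[OF _ LIMSEQ_Suc] by fastforce
  \<comment> \<open>The drops in height tend to 0 and bound the inverse square of
    \<open>norm (pole_sum (s n))\<close>. A drop controls the later of its two points, hence the
    shift to \<open>Suc N\<close>.\<close>
  have large: "\<exists>N. \<forall>n\<ge>N. B < norm (pole_sum (s n))" if "0 < B" for B
  proof -
    obtain N where N: "\<And>n. n \<ge> N \<Longrightarrow> Im (s n) - Im (s (Suc n)) < 1 / B\<^sup>2"
      using order_tendstoD(2)[OF lim, of "1 / B\<^sup>2"] \<open>0 < B\<close> by (auto simp: eventually_sequentially)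
    have "B < norm (pole_sum (s n))" if "n \<ge> Suc N" for n
    proof -
      obtain m where m: "n = Suc m" "m \<ge> N"
        using \<open>n \<ge> Suc N\<close> by (cases n) auto
      define b where "b = norm (pole_sum (s n))"
      have "0 < b"
        using pole_sum_nonzero[OF pos] by (simp add: b_def)
      have "1 / b\<^sup>2 < 1 / B\<^sup>2"
        using drop[of m] N[OF m(2)] by (simp add: b_def m(1))
      then have "B\<^sup>2 < b\<^sup>2"
        using \<open>0 < b\<close> \<open>0 < B\<close> by (simp add: field_simps)
      then show ?thesis
        using \<open>0 < b\<close> unfolding b_def by (intro power2_less_imp_less[of B]) auto
    qed
    then show ?thesis
      by blast
  qed
  obtain N where N: "\<And>n. n \<ge> N \<Longrightarrow> 2 < norm (pole_sum (s n))"
    using large[of 2] by auto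
  obtain k where k: "norm (s N - pole k) < (1 / 4) ^ (k + 4)"
    using near_some_pole[OF pos N[OF order_refl]] by blast
  have near: "norm (s n - pole k) < (1 / 4) ^ (k + 4)" if "n \<ge> N" for n
    using that
  proof (induction n rule: dec_induct)
    case (step n)
    obtain j where j: "norm (s (Suc n) - pole j) < (1 / 4) ^ (j + 4)"
      using near_some_pole[OF pos N[of "Suc n"]] step.hyps by auto
    have "j = k"
      by (rule stays_near_pole[OF pos _ j]) (use step.IH assms(2) in simp)
    then show ?case
      using j by simp
  qed (rule k)
  \<comment> \<open>The bound valid near \<open>pole k\<close>, which the unbounded growth of
    \<open>pole_sum\<close> along the orbit must exceed.\<close>
  define B where "B = 2 + mass k / depth k"
  have "0 < B"
    using mass_pos[of k] depth_pos[of k] by (simp add: B_def add_pos_pos)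
  then obtain M where M: "\<And>n. n \<ge> M \<Longrightarrow> B < norm (pole_sum (s n))"
    using large by blast
  have "norm (pole_sum (s (max M N))) \<le> B"
    unfolding B_def by (rule pole_sum_bounded_near_pole[OF pos near]) simp
  then show False
    using M[of "max M N"] by simp
qed

section \<open>Finite backward orbits by Brouwer's fixed point theorem\<close>

text \<open>
  In terms of \<open>v = - \<i> * \<zeta> * pole_sum (pole k + \<zeta>)\<close> the equation reads \<open>\<zeta> * (1 + v) / v = W\<close>,
  which is a fixed point equation for Brouwer's theorem.
\<close>

lemma halfplane_map_preimage:
  assumes "0 < R"
    and inside: "\<And>\<zeta>. \<zeta> \<in> cball c R \<Longrightarrow> depth k < Im \<zeta> \<and> norm \<zeta> \<le> (1 / 2) ^ k / 4"
    and contract: "\<And>\<zeta> v. \<zeta> \<in> cball c R \<Longrightarrow> norm (v - of_real (mass k) + \<i> * \<zeta>) \<le> norm \<zeta> / 64 \<Longrightarrow>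
      1 + v \<noteq> 0 \<and> norm (W * v / (1 + v) - c) \<le> R"
  obtains \<zeta> where "\<zeta> \<in> cball c R" "halfplane_map (pole k + \<zeta>) = pole k + W"
proof -
  define v where "v = (\<lambda>\<zeta>. - \<i> * \<zeta> * pole_sum (pole k + \<zeta>))"
  have Im_pos: "0 < Im (pole k + \<zeta>)" if "\<zeta> \<in> cball c R" for \<zeta>
    using inside[OF that] by simp
  have nz: "\<zeta> \<noteq> 0" if "\<zeta> \<in> cball c R" for \<zeta>
    using inside[OF that] depth_pos[of k] by auto
  \<comment> \<open>The term of \<open>pole k\<close> contributes exactly \<open>mass k\<close> to
    \<open>v\<close>, the constant 1 contributes \<open>- \<i> * \<zeta>\<close>, and the other
    poles at most \<open>norm \<zeta> / 64\<close>.\<close>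
  have v: "norm (v \<zeta> - of_real (mass k) + \<i> * \<zeta>) \<le> norm \<zeta> / 64" if "\<zeta> \<in> cball c R" for \<zeta>
  proof -
    have "\<bar>Re (pole k + \<zeta>) - (1 / 2) ^ k\<bar> \<le> (1 / 2) ^ k / 4"
      using inside[OF that] abs_Re_le_cmod[of \<zeta>] by simp
    then have "norm (pole_sum (pole k + \<zeta>) - 1 - pole_term k (pole k + \<zeta>)) \<le> 1 / 64"
      by (rule pole_sum_near[OF Im_pos[OF that]])
    then have "norm \<zeta> * norm (pole_sum (pole k + \<zeta>) - 1 - pole_term k (pole k + \<zeta>)) \<le> norm \<zeta> * (1 / 64)"
      by (rule mult_left_mono) simp
    moreover have "v \<zeta> - of_real (mass k) + \<i> * \<zeta>
        = - \<i> * (\<zeta> * (pole_sum (pole k + \<zeta>) - 1 - pole_term k (pole k + \<zeta>)))"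
      using nz[OF that] by (simp add: v_def pole_term_def field_simps)
    ultimately show ?thesis
      by (simp add: norm_mult)
  qed
  have cont: "continuous_on (cball c R) v"
  proof -
    have "continuous_on {z. 0 < Im z} pole_sum"
      by (rule holomorphic_on_imp_continuous_on[OF holomorphic_pole_sum])
    then have "continuous_on (cball c R) (\<lambda>\<zeta>. pole_sum (pole k + \<zeta>))"
      by (rule continuous_on_compose2) (intro continuous_intros, use Im_pos in blast)
    then show ?thesis
      unfolding v_def by (intro continuous_intros)
  qed
  have "continuous_on (cball c R) (\<lambda>\<zeta>. W * v \<zeta> / (1 + v \<zeta>))"
    using contract[OF _ v] by (intro continuous_intros cont) auto
  moreover have "(\<lambda>\<zeta>. W * v \<zeta> / (1 + v \<zeta>)) \<in> cball c R \<rightarrow> cball c R"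
    using contract[OF _ v] by (auto simp: dist_norm norm_minus_commute)
  ultimately obtain \<zeta> where \<zeta>: "\<zeta> \<in> cball c R" "W * v \<zeta> / (1 + v \<zeta>) = \<zeta>"
    using brouwer_ball[OF \<open>0 < R\<close>] by blast
  have "1 + v \<zeta> \<noteq> 0"
    using contract[OF \<zeta>(1) v[OF \<zeta>(1)]] by simp
  then have "W * v \<zeta> = \<zeta> * (1 + v \<zeta>)"
    using \<zeta>(2) by (simp add: divide_eq_eq)
  moreover have C: "pole_sum (pole k + \<zeta>) \<noteq> 0"
    by (rule pole_sum_nonzero[OF Im_pos[OF \<zeta>(1)]])
  ultimately have "\<zeta> * (W * (- \<i> * pole_sum (pole k + \<zeta>)))
      = \<zeta> * ((\<zeta> + \<i> / pole_sum (pole k + \<zeta>)) * (- \<i> * pole_sum (pole k + \<zeta>)))"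
    by (simp add: v_def algebra_simps)
  then have "W = \<zeta> + \<i> / pole_sum (pole k + \<zeta>)"
    using nz[OF \<zeta>(1)] C by (simp only: mult_cancel_left mult_cancel_right) simp
  then show thesis
    using that[OF \<zeta>(1)] by (simp add: halfplane_map_def add.assoc)
qed

lemma norm_1_plus_ge: "1 - norm v \<le> norm (1 + v)" for v :: complex
  using norm_triangle_ineq4[of "1 + v" v] by simp

text \<open>For \<open>W = \<i> / 2\<close> and \<open>v = \<nu> - \<i> * \<zeta>\<close>, the
  difference \<open>W * v - \<i> * \<nu>\<close> is \<open>(\<zeta> - \<i> * \<nu>) / 2\<close>, so
  the disc is halved. The deviations of \<open>W\<close> and \<open>v\<close> and the denominator
  \<open>1 + v\<close> fit into the remaining half.\<close>

lemma contraction_first_step: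
  fixes v W \<zeta> :: complex and \<nu> :: real
  assumes \<nu>: "0 < \<nu>" "\<nu> \<le> 1 / 512"
    and W: "norm (W - \<i> / 2) \<le> 1 / 30"
    and \<zeta>: "norm (\<zeta> - \<i> * \<nu>) \<le> \<nu> / 2"
    and v: "norm (v - \<nu> + \<i> * \<zeta>) \<le> norm \<zeta> / 64"
  shows "1 + v \<noteq> 0" "norm (W * v / (1 + v) - \<i> * \<nu>) \<le> \<nu> / 2"
proof -
  have "norm \<zeta> \<le> 3 / 2 * \<nu>"
    using norm_triangle_ineq[of "\<zeta> - \<i> * \<nu>" "\<i> * \<nu>"] \<zeta> \<nu> by (simp add: norm_mult)
  define e where "e = v - \<nu> + \<i> * \<zeta>"
  have e: "norm e \<le> 3 / 128 * \<nu>"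
    using v \<open>norm \<zeta> \<le> 3 / 2 * \<nu>\<close> by (simp add: e_def)
  have v_eq: "v = \<nu> - \<i> * \<zeta> + e"
    by (simp add: e_def)
  have "norm v \<le> norm (of_real \<nu> - \<i> * \<zeta>) + norm e"
    unfolding v_eq by (rule norm_triangle_ineq)
  also have "norm (of_real \<nu> - \<i> * \<zeta>) \<le> norm (of_real \<nu> :: complex) + norm (\<i> * \<zeta>)"
    by (rule norm_triangle_ineq4)
  also have "\<dots> \<le> 5 / 2 * \<nu>"
    using \<open>norm \<zeta> \<le> 3 / 2 * \<nu>\<close> \<nu> by (simp add: norm_mult)
  finally have nv: "norm v \<le> 2.53 * \<nu>"
    using e \<nu> by simp
  then have "norm v \<le> 0.005"
    using \<nu> by simp
  then have d: "0.995 \<le> norm (1 + v)"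
    using norm_1_plus_ge[of v] by simp
  then show "1 + v \<noteq> 0"
    by auto
  have "W * v - \<i> * \<nu> = (\<zeta> - \<i> * \<nu>) / 2 + (\<i> / 2) * e + (W - \<i> / 2) * v"
    by (simp add: v_eq algebra_simps add_divide_distrib diff_divide_distrib)
  also have "norm \<dots> \<le> norm ((\<zeta> - \<i> * \<nu>) / 2) + norm ((\<i> / 2) * e) + norm ((W - \<i> / 2) * v)"
    by (intro order_trans[OF norm_triangle_ineq] add_right_mono norm_triangle_ineq)
  also have "\<dots> \<le> \<nu> / 4 + 3 / 256 * \<nu> + 1 / 30 * (2.53 * \<nu>)"
    using \<zeta> e mult_mono[OF W nv] by (simp add: norm_mult norm_divide)
  also have "\<dots> \<le> 0.35 * \<nu>"
    using \<nu> by simp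
  finally have A: "norm (W * v - \<i> * \<nu>) \<le> 0.35 * \<nu>" .
  have "norm W \<le> 0.54"
    using norm_triangle_ineq[of "W - \<i> / 2" "\<i> / 2"] W by (simp add: norm_divide)
  have "W * v / (1 + v) - \<i> * \<nu> = ((W * v - \<i> * \<nu>) - \<i> * \<nu> * v) / (1 + v)"
    using \<open>1 + v \<noteq> 0\<close> by (simp add: field_simps)
  also have "norm \<dots> \<le> (0.35 * \<nu> + \<nu> * 0.005) / 0.995"
  proof -
    have "norm (\<i> * \<nu> * v) \<le> \<nu> * 0.005"
      using \<open>norm v \<le> 0.005\<close> \<nu> by (simp add: norm_mult)
    then have "norm ((W * v - \<i> * \<nu>) - \<i> * \<nu> * v) \<le> 0.35 * \<nu> + \<nu> * 0.005"
      using A norm_triangle_ineq4[of "W * v - \<i> * \<nu>" "\<i> * \<nu> * v"] by linarith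
    then show ?thesis
      unfolding norm_divide using d \<nu> by (intro frac_le) auto
  qed
  also have "\<dots> \<le> \<nu> / 2"
    using \<nu> by simp
  finally show "norm (W * v / (1 + v) - \<i> * \<nu>) \<le> \<nu> / 2" .
qed

text \<open>Here \<open>\<zeta>\<close> is of order \<open>\<nu>\<^sup>2\<close>, so
  \<open>v / (1 + v)\<close> differs from \<open>\<nu>\<close> by at most
  \<open>7 / 2 * \<nu>\<^sup>2\<close>. Pulling back thus multiplies by nearly \<open>\<nu>\<close>,
  and as \<open>norm W \<le> 2 * q\<close>, the relative error \<open>\<rho>\<close> grows by at
  most \<open>7 * \<nu>\<close>.\<close>

lemma contraction_later_step:
  fixes v W \<zeta> :: complex and \<nu> \<rho> q :: real
  assumes \<nu>: "0 < \<nu>" "\<nu> \<le> 1 / 512"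
    and q: "0 < q" "q \<le> \<nu>" "\<rho> \<le> 3 / 4"
    and W: "norm (W - \<i> * q) \<le> q * \<rho>"
    and \<zeta>: "norm \<zeta> \<le> 2 * (q * \<nu>)"
    and v: "norm (v - \<nu> + \<i> * \<zeta>) \<le> norm \<zeta> / 64"
  shows "1 + v \<noteq> 0" "norm (W * v / (1 + v) - \<i> * (q * \<nu>)) \<le> q * \<nu> * (\<rho> + 7 * \<nu>)"
proof -
  have "q * \<nu> \<le> \<nu> * \<nu>"
    using q \<nu> by (intro mult_right_mono) auto
  have "norm (v - \<nu>) \<le> norm (v - \<nu> + \<i> * \<zeta>) + norm (\<i> * \<zeta>)"
    using norm_triangle_ineq4[of "v - \<nu> + \<i> * \<zeta>" "\<i> * \<zeta>"] by simp
  also have "\<dots> \<le> norm \<zeta> * (65 / 64)"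
    using v by (simp add: norm_mult)
  also have "\<dots> \<le> (51 / 25) * (\<nu> * \<nu>)"
    using \<zeta> \<open>q * \<nu> \<le> \<nu> * \<nu>\<close> zero_le_square[of \<nu>] by linarith
  finally have dv: "norm (v - \<nu>) \<le> (51 / 25) * (\<nu> * \<nu>)" .
  have "\<nu> * \<nu> \<le> 1 / 512 * \<nu>"
    using \<nu> by (intro mult_right_mono) auto
  have nv: "norm v \<le> (251 / 250) * \<nu>"
  proof -
    have "norm v \<le> norm (v - \<nu>) + \<nu>"
      using norm_triangle_ineq[of "v - \<nu>" \<nu>] \<nu> by simp
    then show ?thesis
      using dv \<open>\<nu> * \<nu> \<le> 1 / 512 * \<nu>\<close> \<nu> by linarith
  qed
  then have d: "0.995 \<le> norm (1 + v)"
    using norm_1_plus_ge[of v] \<nu> by simp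
  then show nz: "1 + v \<noteq> 0"
    by auto
  have "norm (v / (1 + v) - \<nu>) \<le> ((61 / 20) * (\<nu> * \<nu>)) / 0.995"
  proof -
    have "v / (1 + v) - \<nu> = ((v - \<nu>) - \<nu> * v) / (1 + v)"
      using nz by (simp add: field_simps)
    also have "norm \<dots> \<le> ((61 / 20) * (\<nu> * \<nu>)) / 0.995"
    proof -
      have "norm (\<nu> * v) \<le> (251 / 250) * (\<nu> * \<nu>)"
        using mult_left_mono[OF nv, of \<nu>] \<nu> by (simp add: norm_mult)
      then have "norm ((v - \<nu>) - \<nu> * v) \<le> (61 / 20) * (\<nu> * \<nu>)"
        using norm_triangle_ineq4[of "v - \<nu>" "\<nu> * v"] dv zero_le_square[of \<nu>] by linarith
      then show ?thesis
        unfolding norm_divide using d \<nu> by (intro frac_le) auto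
    qed
    finally show ?thesis .
  qed
  also have "\<dots> \<le> 7 / 2 * (\<nu> * \<nu>)"
    using \<nu> by simp
  finally have B: "norm (v / (1 + v) - \<nu>) \<le> 7 / 2 * (\<nu> * \<nu>)" .
  have "q * \<rho> \<le> q * (3 / 4)"
    using q by (intro mult_left_mono) auto
  moreover have "norm W \<le> norm (W - \<i> * q) + q"
    using norm_triangle_ineq[of "W - \<i> * q" "\<i> * q"] q by (simp add: norm_mult)
  ultimately have nW: "norm W \<le> 2 * q"
    using W q by linarith
  have "W * v / (1 + v) - \<i> * (q * \<nu>) = (W - \<i> * q) * \<nu> + W * (v / (1 + v) - \<nu>)"
    by (simp add: algebra_simps)
  also have "norm \<dots> \<le> norm ((W - \<i> * q) * \<nu>) + norm (W * (v / (1 + v) - \<nu>))"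
    by (rule norm_triangle_ineq)
  also have "\<dots> \<le> (q * \<rho>) * \<nu> + (2 * q) * (7 / 2 * (\<nu> * \<nu>))"
    unfolding norm_mult using W \<nu> q B nW order_trans[OF norm_ge_zero W]
    by (intro add_mono mult_mono) auto
  also have "\<dots> = q * \<nu> * (\<rho> + 7 * \<nu>)"
    by (simp add: algebra_simps)
  finally show "norm (W * v / (1 + v) - \<i> * (q * \<nu>)) \<le> q * \<nu> * (\<rho> + 7 * \<nu>)" .
qed

text \<open>The second bound keeps the relative error accumulated over up to \<open>Suc k\<close>
  backward steps small.\<close>

lemma mass_le_half_power: "mass k \<le> (1 / 2) ^ k / 512" "mass k * real (Suc k) \<le> 1 / 512"
proof -
  have "(1 / 8 :: real) ^ k \<le> (1 / 2) ^ k"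
    by (rule power_mono) auto
  then show *: "mass k \<le> (1 / 2) ^ k / 512"
    by (simp add: mass_def power_add power_divide)
  have "real (Suc k) \<le> 2 ^ k"
    using of_nat_mono[OF Suc_leI[OF less_exp[of k]], where 'a = real] by simp
  then have "mass k * real (Suc k) \<le> (1 / 2) ^ k / 512 * 2 ^ k"
    using * by (intro mult_mono) auto
  then show "mass k * real (Suc k) \<le> 1 / 512"
    by (simp add: power_divide)
qed

text \<open>Each pull-back towards \<open>pole k\<close> shrinks the offset by about
  \<open>mass k\<close>. The relative error is 1/2 after the first one and grows by at most
  \<open>7 * mass k\<close> with each further one, so it stays below 3/4 and the offset stays above
  the depth.\<close>

lemma backward_chain:
  assumes "5 \<le> k" "i \<le> k"
  shows "\<exists>\<zeta>. norm (\<zeta> - \<i> * mass k ^ Suc i) \<le> mass k ^ Suc i * (1 / 2 + 7 * mass k * i) \<and>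
    (halfplane_map ^^ Suc i) (pole k + \<zeta>) = \<i> / 2"
  using assms(2)
proof (induction i)
  case 0
  define \<nu> where "\<nu> = mass k"
  define W where "W = \<i> / 2 - pole k"
  have \<nu>: "0 < \<nu>" "\<nu> \<le> 1 / 512" "\<nu> \<le> (1 / 2) ^ k / 512"
    using mass_pos mass_le mass_le_half_power by (simp_all add: \<nu>_def)
  have "depth k \<le> \<nu> / 8"
    using power_decreasing[of 1 "Suc k" \<nu>] \<nu> by (simp add: depth_def \<nu>_def del: power_Suc)
  have "norm (W - \<i> / 2) = norm (pole k)"
    by (simp add: W_def)
  also have "\<dots> \<le> (1 / 2) ^ k + depth k"
    using cmod_le[of "pole k"] depth_pos[of k] by simp
  \<comment> \<open>The condition \<open>5 \<le> k\<close> puts the pole close enough to 0 for the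
    offset of \<open>\<i> / 2\<close> from it to be nearly \<open>\<i> / 2\<close>.\<close>
  also have "\<dots> \<le> (1 / 2) ^ 5 + 1 / 512"
  proof (rule add_mono)
    show "(1 / 2 :: real) ^ k \<le> (1 / 2) ^ 5"
      by (rule power_decreasing[OF \<open>5 \<le> k\<close>]) auto
    show "depth k \<le> 1 / 512"
      using \<open>depth k \<le> \<nu> / 8\<close> \<nu> by linarith
  qed
  also have "\<dots> \<le> 1 / 30"
    by (simp add: power_divide)
  finally have W: "norm (W - \<i> / 2) \<le> 1 / 30" .
  obtain \<zeta> where \<zeta>: "\<zeta> \<in> cball (\<i> * \<nu>) (\<nu> / 2)" "halfplane_map (pole k + \<zeta>) = pole k + W"
  proof (rule halfplane_map_preimage[of "\<nu> / 2" "\<i> * \<nu>" k W])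
    show "0 < \<nu> / 2"
      using \<nu> by simp
    fix \<zeta>
    assume "\<zeta> \<in> cball (\<i> * \<nu>) (\<nu> / 2)"
    then have *: "norm (\<zeta> - \<i> * \<nu>) \<le> \<nu> / 2"
      by (simp add: dist_norm norm_minus_commute)
    have "\<nu> / 2 \<le> Im \<zeta>"
      using abs_Im_le_cmod[of "\<zeta> - \<i> * \<nu>"] * by simp
    moreover have "norm \<zeta> \<le> 2 * \<nu>"
      using norm_triangle_ineq[of "\<zeta> - \<i> * \<nu>" "\<i> * \<nu>"] * \<nu> by (simp add: norm_mult)
    ultimately show "depth k < Im \<zeta> \<and> norm \<zeta> \<le> (1 / 2) ^ k / 4"
      using \<open>depth k \<le> \<nu> / 8\<close> \<nu> by simp
    show "1 + v \<noteq> 0 \<and> norm (W * v / (1 + v) - \<i> * \<nu>) \<le> \<nu> / 2"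
      if "norm (v - of_real (mass k) + \<i> * \<zeta>) \<le> norm \<zeta> / 64" for v
      using contraction_first_step[OF \<nu>(1,2) W *] that by (simp add: \<nu>_def)
  qed
  then show ?case
    by (intro exI[of _ \<zeta>]) (simp add: \<nu>_def W_def dist_norm norm_minus_commute)
next
  case (Suc i)
  then obtain W where W: "norm (W - \<i> * mass k ^ Suc i) \<le> mass k ^ Suc i * (1 / 2 + 7 * mass k * i)"
    and orbit: "(halfplane_map ^^ Suc i) (pole k + W) = \<i> / 2"
    by auto
  define \<nu> where "\<nu> = mass k"
  define q where "q = \<nu> ^ Suc i"
  define \<rho> where "\<rho> = 1 / 2 + 7 * \<nu> * i"
  have \<nu>: "0 < \<nu>" "\<nu> \<le> 1 / 512" "\<nu> \<le> (1 / 2) ^ k / 512"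
    using mass_pos mass_le mass_le_half_power by (simp_all add: \<nu>_def)
  have "\<nu> * Suc i \<le> \<nu> * Suc k"
    using Suc.prems \<nu> by (intro mult_left_mono) auto
  then have "\<nu> * Suc i \<le> 1 / 512"
    using mass_le_half_power(2)[of k] by (simp add: \<nu>_def)
  then have \<rho>: "\<rho> + 7 * \<nu> \<le> 3 / 4"
    by (simp add: \<rho>_def algebra_simps)
  have q: "0 < q" "q \<le> \<nu>"
    using \<nu> power_decreasing[of 1 "Suc i" \<nu>] by (simp_all add: q_def del: power_Suc)
  have "q * \<nu> \<le> \<nu> * (1 / 512)"
    using q \<nu> by (intro mult_mono) auto
  \<comment> \<open>This is where the length of the chain is limited: \<open>q * \<nu>\<close> is
    the power \<open>Suc (Suc i)\<close> of \<open>\<nu>\<close>, and the depth contains the power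
    \<open>Suc k\<close>.\<close>
  have "depth k \<le> q * \<nu> / 8"
    using power_decreasing[of "Suc (Suc i)" "Suc k" \<nu>] Suc.prems \<nu>
    by (simp add: depth_def \<nu>_def q_def mult.commute)
  define R where "R = q * \<nu> * (\<rho> + 7 * \<nu>)"
  have "0 < R"
    using q \<nu> by (simp add: R_def \<rho>_def add_pos_nonneg)
  have R: "R \<le> q * \<nu> * (3 / 4)"
    unfolding R_def using \<rho> q \<nu> by (intro mult_left_mono) auto
  have "0 < q * \<nu>"
    using q \<nu> by simp
  obtain \<zeta> where \<zeta>: "\<zeta> \<in> cball (\<i> * (q * \<nu>)) R" "halfplane_map (pole k + \<zeta>) = pole k + W"
  proof (rule halfplane_map_preimage[OF \<open>0 < R\<close>, of "\<i> * (q * \<nu>)" k W])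
    fix \<zeta>
    assume "\<zeta> \<in> cball (\<i> * (q * \<nu>)) R"
    then have *: "norm (\<zeta> - \<i> * (q * \<nu>)) \<le> R"
      by (simp add: dist_norm norm_minus_commute)
    have "q * \<nu> / 4 \<le> Im \<zeta>"
      using abs_Im_le_cmod[of "\<zeta> - \<i> * (q * \<nu>)"] * R by simp
    moreover have n\<zeta>: "norm \<zeta> \<le> 2 * (q * \<nu>)"
      using norm_triangle_ineq[of "\<zeta> - \<i> * (q * \<nu>)" "\<i> * (q * \<nu>)"] * R \<open>0 < q * \<nu>\<close>
      by (simp add: norm_mult)
    ultimately show "depth k < Im \<zeta> \<and> norm \<zeta> \<le> (1 / 2) ^ k / 4"
      using \<open>depth k \<le> q * \<nu> / 8\<close> \<open>0 < q * \<nu>\<close> \<open>q * \<nu> \<le> \<nu> * (1 / 512)\<close> \<nu> by linarith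
    show "1 + v \<noteq> 0 \<and> norm (W * v / (1 + v) - \<i> * (q * \<nu>)) \<le> R"
      if "norm (v - of_real (mass k) + \<i> * \<zeta>) \<le> norm \<zeta> / 64" for v
      using contraction_later_step[OF \<nu>(1,2) q _ _ n\<zeta>, of \<rho> W v] that W \<rho> \<nu>
      by (simp add: \<nu>_def[symmetric] q_def[symmetric] \<rho>_def[symmetric] R_def del: power_Suc)
  qed
  have "(halfplane_map ^^ Suc (Suc i)) (pole k + \<zeta>) = \<i> / 2"
    using orbit by (simp only: funpow_Suc_right[of "Suc i"] o_apply \<zeta>(2))
  moreover have "norm (\<zeta> - \<i> * mass k ^ Suc (Suc i))
      \<le> mass k ^ Suc (Suc i) * (1 / 2 + 7 * mass k * Suc i)"
    using \<zeta>(1) by (simp add: dist_norm norm_minus_commute q_def \<nu>_def R_def \<rho>_def algebra_simps)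
  ultimately show ?case
    by blast
qed

lemma attracting_halfplane_map: "\<i> / 2 \<in> attracting_set {z. 0 < Im z} halfplane_map"
  unfolding attracting_set_def
proof (rule INT_I)
  fix n
  show "\<i> / 2 \<in> (halfplane_map ^^ n) ` {z. 0 < Im z}"
  proof (cases n)
    case (Suc i)
    \<comment> \<open>The choice meets both requirements of \<open>backward_chain\<close>:
      \<open>5 \<le> k\<close> and \<open>i \<le> k\<close>.\<close>
    define k where "k = i + 5"
    define q where "q = mass k ^ Suc i"
    obtain \<zeta> where \<zeta>: "norm (\<zeta> - \<i> * q) \<le> q * (1 / 2 + 7 * mass k * i)"
      "(halfplane_map ^^ Suc i) (pole k + \<zeta>) = \<i> / 2"
      using backward_chain[of k i] by (auto simp: k_def q_def)
    have "0 < q"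
      using mass_pos by (simp add: q_def)
    have "mass k * i \<le> mass k * Suc k"
      using mass_pos[of k] by (intro mult_left_mono) (auto simp: k_def)
    then have "1 / 2 + 7 * mass k * i \<le> 3 / 4"
      using mass_le_half_power(2)[of k] by simp
    then have "q * (1 / 2 + 7 * mass k * i) \<le> q * (3 / 4)"
      using \<open>0 < q\<close> by (intro mult_left_mono) auto
    then have "q / 4 \<le> Im \<zeta>"
      using abs_Im_le_cmod[of "\<zeta> - \<i> * q"] \<zeta>(1) by simp
    moreover have "depth k \<le> q / 8"
      using power_decreasing[of "Suc i" "Suc k" "mass k"] mass_le[of k] mass_pos[of k]
      by (simp add: depth_def q_def k_def del: power_Suc)
    ultimately have "pole k + \<zeta> \<in> {z. 0 < Im z}"
      using \<open>0 < q\<close> by simp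
    then show ?thesis
      using \<zeta>(2) unfolding Suc by (metis imageI)
  qed simp
qed

lemma stable_halfplane_map: "stable_set {z. 0 < Im z} halfplane_map = {}"
  unfolding stable_set_def using no_infinite_backward_orbit by blast

section \<open>Transport to the unit disc\<close>

lemma funpow_conjugate:
  assumes "\<And>x. x \<in> A \<Longrightarrow> \<phi> x \<in> A" "\<And>x. x \<in> A \<Longrightarrow> \<psi> (f x) = f (\<phi> x)" "x \<in> A"
  shows "(\<phi> ^^ n) x \<in> A \<and> (\<psi> ^^ n) (f x) = f ((\<phi> ^^ n) x)"
  using assms by (induction n) auto

text \<open>Applied to the Cayley transform, from the half-plane to the disc.\<close>

lemma attracting_set_conjugate:
  assumes "\<And>x. x \<in> A \<Longrightarrow> \<phi> x \<in> A" "\<And>x. x \<in> A \<Longrightarrow> \<psi> (f x) = f (\<phi> x)" "f ` A \<subseteq> B"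
    and "x \<in> attracting_set A \<phi>"
  shows "f x \<in> attracting_set B \<psi>"
  unfolding attracting_set_def
proof (rule INT_I)
  fix n
  obtain y where "y \<in> A" "x = (\<phi> ^^ n) y"
    using assms(4) by (auto simp: attracting_set_def)
  then show "f x \<in> (\<psi> ^^ n) ` B"
    using funpow_conjugate[of A \<phi> \<psi> f y n] assms(1-3) by (metis image_eqI image_subset_iff)
qed

text \<open>Applied to the inverse Cayley transform, so that a backward orbit in the disc yields one
  in the half-plane.\<close>

lemma stable_set_conjugate:
  assumes "\<And>x. x \<in> A \<Longrightarrow> \<phi> x \<in> A" "\<And>x. x \<in> A \<Longrightarrow> \<psi> (f x) = f (\<phi> x)" "f ` A \<subseteq> B"
    and "x \<in> stable_set A \<phi>"
  shows "f x \<in> stable_set B \<psi>"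
proof -
  obtain s where "\<forall>n. s n \<in> A" "s 0 = x" "\<forall>n. \<phi> (s (Suc n)) = s n"
    using assms(4) by (auto simp: stable_set_def)
  then show ?thesis
    unfolding stable_set_def using assms(2,3)
    by (intro CollectI conjI exI[of _ "\<lambda>n. f (s n)"]) auto
qed

lemma cayley_in_disc: "0 < Im z \<Longrightarrow> norm ((z - \<i>) / (z + \<i>)) < 1"
proof -
  assume "0 < Im z"
  then have "norm (z - \<i>) < norm (z + \<i>)"
    by (simp add: cmod_def power2_eq_square algebra_simps)
  then show ?thesis
    by (simp add: norm_divide divide_less_eq)
qed

lemma inverse_cayley_in_halfplane:
  assumes "norm w < 1"
  shows "0 < Im (\<i> * (1 + w) / (1 - w))"
proof -
  have "w \<noteq> 1"
    using assms by auto
  then have "0 < (norm (1 - w))\<^sup>2"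
    by simp
  moreover have "(Re w)\<^sup>2 + (Im w)\<^sup>2 < 1"
    using assms by (simp add: cmod_def)
  moreover have "Im (\<i> * (1 + w) / (1 - w)) = (1 - ((Re w)\<^sup>2 + (Im w)\<^sup>2)) / (norm (1 - w))\<^sup>2"
    unfolding Im_divide cmod_power2 by (simp add: power2_eq_square algebra_simps)
  ultimately show ?thesis
    by simp
qed

text \<open>The witness is \<open>halfplane_map\<close> conjugated by the Cayley transform
  \<open>f\<close> with inverse \<open>g\<close>; its stable set is empty, while its attracting set
  contains \<open>f (\<i> / 2)\<close>.\<close>

lemma disc_map_exists:
  "\<exists>\<phi> :: complex \<Rightarrow> complex. \<phi> analytic_on ball 0 1 \<and> (\<forall>z\<in>ball 0 1. cmod (\<phi> z) < 1) \<and>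
     stable_set (ball 0 1) \<phi> \<noteq> attracting_set (ball 0 1) \<phi>"
proof -
  define H where "H = {z. 0 < Im z}"
  define f :: "complex \<Rightarrow> complex" where "f = (\<lambda>z. (z - \<i>) / (z + \<i>))"
  define g :: "complex \<Rightarrow> complex" where "g = (\<lambda>w. \<i> * (1 + w) / (1 - w))"
  define \<psi> where "\<psi> = (\<lambda>w. f (halfplane_map (g w)))"
  have f_in: "f z \<in> ball 0 1" if "z \<in> H" for z
    using cayley_in_disc[of z] that by (simp add: f_def H_def)
  have g_in: "g w \<in> H" if "w \<in> ball 0 1" for w
    using inverse_cayley_in_halfplane[of w] that by (simp add: g_def H_def)
  have gf: "g (f z) = z" if "z \<in> H" for z
  proof -
    have "z + \<i> \<noteq> 0"
      using that by (auto simp: H_def complex_eq_iff)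
    then have "1 + f z = 2 * z / (z + \<i>)" "1 - f z = 2 * \<i> / (z + \<i>)"
      by (simp_all add: f_def field_simps)
    then show ?thesis
      using \<open>z + \<i> \<noteq> 0\<close> by (simp add: g_def)
  qed
  have map_in: "halfplane_map z \<in> H" if "z \<in> H" for z
    using halfplane_map_in[of z] that by (simp add: H_def)
  have "g holomorphic_on ball 0 1"
    unfolding g_def by (intro holomorphic_intros) auto
  moreover have "halfplane_map holomorphic_on H"
    unfolding H_def by (rule holomorphic_halfplane_map)
  moreover have "f holomorphic_on H"
    unfolding f_def by (intro holomorphic_intros) (auto simp: H_def complex_eq_iff)
  ultimately have "(f \<circ> (halfplane_map \<circ> g)) holomorphic_on ball 0 1"
    by (intro holomorphic_on_compose_gen[where t = H]) (use g_in map_in in auto)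
  then have "\<psi> analytic_on ball 0 1"
    by (simp add: analytic_on_open \<psi>_def o_def)
  moreover have "\<forall>z\<in>ball 0 1. cmod (\<psi> z) < 1"
    using f_in[OF map_in[OF g_in]] by (simp add: \<psi>_def)
  moreover have "f (\<i> / 2) \<in> attracting_set (ball 0 1) \<psi>"
    by (rule attracting_set_conjugate[OF map_in])
      (use f_in gf attracting_halfplane_map in \<open>auto simp: \<psi>_def H_def\<close>)
  moreover have "stable_set (ball 0 1) \<psi> = {}"
  proof -
    have "g w \<in> stable_set H halfplane_map" if "w \<in> stable_set (ball 0 1) \<psi>" for w
      by (rule stable_set_conjugate[OF _ _ _ that])
        (use f_in[OF map_in[OF g_in]] gf[OF map_in[OF g_in]] g_in in \<open>auto simp: \<psi>_def\<close>)
    then show ?thesis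
      using stable_halfplane_map by (auto simp: H_def)
  qed
  ultimately show ?thesis
    by blast
qed

theorem theorem1p1:
  shows "(\<exists>(V :: (complex, nat \<Rightarrow> complex) module) ip B \<phi>.
            complex_hilbert_space V ip \<and>
            hilbert_base V ip B \<and> countable B \<and> infinite B \<and>
            linear_self_map V \<phi> \<and>
            continuous_map (hilbert_topology V ip) (hilbert_topology V ip) \<phi> \<and>
            hilbert_topology V ip closure_of (\<phi> ` carrier V) = carrier V \<and>
            stable_set (carrier V) \<phi> \<noteq> attracting_set (carrier V) \<phi>)
       \<and>
         (\<exists>\<phi> :: complex \<Rightarrow> complex.
            \<phi> analytic_on ball 0 1 \<and>
            (\<forall>z\<in>ball 0 1. cmod (\<phi> z) < 1) \<and>
            stable_set (ball 0 1) \<phi> \<noteq> attracting_set (ball 0 1) \<phi>)"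
proof
  show "\<exists>(V :: (complex, nat \<Rightarrow> complex) module) ip B \<phi>.
            complex_hilbert_space V ip \<and>
            hilbert_base V ip B \<and> countable B \<and> infinite B \<and>
            linear_self_map V \<phi> \<and>
            continuous_map (hilbert_topology V ip) (hilbert_topology V ip) \<phi> \<and>
            hilbert_topology V ip closure_of (\<phi> ` carrier V) = carrier V \<and>
            stable_set (carrier V) \<phi> \<noteq> attracting_set (carrier V) \<phi>"
  proof (intro exI conjI)
    show "countable (range unit_seq)" "infinite (range unit_seq)"
      by (simp_all add: range_inj_infinite[OF inj_unit_seq])
    show "ell2.mtopology closure_of (tree_op ` carrier ell2_module) = carrier ell2_module"
      using dense_range_tree_op by simp
    show "stable_set (carrier ell2_module) tree_op \<noteq> attracting_set (carrier ell2_module) tree_op"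
      using root_in_attracting_set root_not_in_stable_set by auto
  qed (fact complex_hilbert_space_ell2 hilbert_base_ell2 linear_tree_op continuous_tree_op)+
qed (rule disc_map_exists)

end
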